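(* Let $K$ be a field, $S=K[x_1,\ldots,x_n]$, and let $d\ge 1$, $r\ge 1$ be integers. Let $J\subsetneq I$ be squarefree monomial ideals of $S$ such that the minimal set of monomial generators of $I$ consists of squarefree monomials $f_1,\ldots,f_r$ of degree $d$ together with a (possibly empty) set $E$ of squarefree monomials of degree $\ge d+1$, and such that $J$ is zero or generated by monomials of degree $\ge d+1$. Let $B$ (resp. $C$) be the set of squarefree monomials of degree $d+1$ (resp. $d+2$) in $I\setminus J$, and let $W=\{w_{ij}: 1\le i<j\le r\}$, where $w_{ij}=\operatorname{lcm}(f_i,f_j)$. If $B\cap (f_1,\ldots,f_r)\subset W$ and $C\cap W=\emptyset$, then $\operatorname{depth}_S I/J\le d+1$.
   Context: $(f_1,\ldots,f_r)$ denotes the ideal of $S$ generated by $f_1,\ldots,f_r$. Depth of a finitely generated graded $S$-module is taken with respect to the maximal ideal $(x_1,\ldots,x_n)$. *)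

theory Defs
  imports
    "HOL-Algebra.Algebraic_Closure_Type"
    "HOL-Library.Poly_Mapping"
    "HOL-Library.Extended_Nat"
begin

section \<open>Quotient modules and depth\<close>

text \<open>An ideal of \<open>R\<close>, regarded as an \<open>R\<close>-module.\<close>

definition ideal_module :: "('a, 'c) ring_scheme \<Rightarrow> 'a set \<Rightarrow> ('a, 'a) module" where
  "ideal_module R I =
     \<lparr>carrier = I, monoid.mult = monoid.mult R, one = one R, ring.zero = ring.zero R,
      add = add R, module.smult = monoid.mult R\<rparr>"

text \<open>
  The quotient \<open>M / N\<close>. The fields \<open>mult\<close> and \<open>one\<close> of the record are not used by the
  locale \<open>module\<close>, hence left unspecified. As for \<^const>\<open>rcoset_mult\<close>, the union in the
  scalar multiplication is a union of equal cosets.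
\<close>

definition quot_module :: "('a, 'b, 'c) module_scheme \<Rightarrow> 'b set \<Rightarrow> ('a, 'b set) module" where
  "quot_module M N =
     \<lparr>carrier = a_rcosets\<^bsub>M\<^esub> N, monoid.mult = undefined, one = undefined, ring.zero = N,
      add = set_add M, module.smult = (\<lambda>a A. \<Union>x\<in>A. N +>\<^bsub>M\<^esub> (a \<odot>\<^bsub>M\<^esub> x))\<rparr>"

text \<open>The submodule \<open>(A)M\<close>, where \<open>(A)\<close> is the ideal generated by the set \<open>A\<close>.\<close>

definition ideal_smult :: "('a, 'c) ring_scheme \<Rightarrow> ('a, 'b, 'd) module_scheme \<Rightarrow> 'a set \<Rightarrow> 'b set" where
  "ideal_smult R M A =
     \<Inter>{N. submodule N R M \<and> (\<forall>a\<in>A. \<forall>x\<in>carrier M. a \<odot>\<^bsub>M\<^esub> x \<in> N)}"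

text \<open>
  Each \<open>a\<^sub>i\<close> is a nonzerodivisor on \<open>M / (a\<^sub>0, \<dots>, a\<^bsub>i-1\<^esub>)M\<close>, and
  \<open>M \<noteq> (a\<^sub>0, \<dots>, a\<^bsub>k-1\<^esub>)M\<close>.
\<close>

definition regular_sequence :: "('a, 'c) ring_scheme \<Rightarrow> ('a, 'b, 'd) module_scheme \<Rightarrow> 'a list \<Rightarrow> bool" where
  "regular_sequence R M as \<longleftrightarrow>
     set as \<subseteq> carrier R \<and>
     (\<forall>i<length as. \<forall>x\<in>carrier M.
        (as ! i) \<odot>\<^bsub>M\<^esub> x \<in> ideal_smult R M (set (take i as)) \<longrightarrow>
        x \<in> ideal_smult R M (set (take i as))) \<and>
     ideal_smult R M (set as) \<noteq> carrier M"

text \<open>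
  The depth of \<open>M\<close> with respect to the ideal \<open>P\<close>, with the usual convention that it is
  infinite if \<open>PM = M\<close> (in particular if \<open>M = 0\<close>).
\<close>

definition depth :: "('a, 'c) ring_scheme \<Rightarrow> 'a set \<Rightarrow> ('a, 'b, 'd) module_scheme \<Rightarrow> enat" where
  "depth R P M =
     (if ideal_smult R M P = carrier M then \<infinity>
      else Sup {enat (length as) | as. set as \<subseteq> P \<and> regular_sequence R M as})"

lemma module_ideal_module:
  assumes "cring R" "ideal I R"
  shows "module R (ideal_module R I)"
proof -
  interpret cring R by fact
  interpret ideal I R by fact
  show ?thesis
  proof (rule moduleI[OF assms(1)])
    show "abelian_group (ideal_module R I)"
    proof (rule abelian_groupI)
      fix x assume "x \<in> carrier (ideal_module R I)"
      then have x: "x \<in> I"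
        by (simp add: ideal_module_def)
      then show "\<exists>y\<in>carrier (ideal_module R I).
          y \<oplus>\<^bsub>ideal_module R I\<^esub> x = \<zero>\<^bsub>ideal_module R I\<^esub>"
        by (intro bexI[of _ "\<ominus>\<^bsub>R\<^esub> x"]) (auto simp: ideal_module_def l_neg)
    next
      fix x y assume "x \<in> carrier (ideal_module R I)" "y \<in> carrier (ideal_module R I)"
      then show "x \<oplus>\<^bsub>ideal_module R I\<^esub> y = y \<oplus>\<^bsub>ideal_module R I\<^esub> x"
        by (auto simp: ideal_module_def intro: a_comm)
    qed (auto simp: ideal_module_def a_assoc)
  qed (auto simp: ideal_module_def l_distr r_distr m_assoc I_l_closed)
qed

lemma submodule_ideal_module:
  assumes "cring R" "ideal I R" "ideal J R" "J \<subseteq> I"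
  shows "submodule J R (ideal_module R I)"
proof -
  interpret R: cring R by fact
  interpret I: ideal I R by fact
  interpret J: ideal J R by fact
  interpret M: module R "ideal_module R I" by (rule module_ideal_module) fact+
  have inv: "\<ominus>\<^bsub>ideal_module R I\<^esub> x = \<ominus>\<^bsub>R\<^esub> x" if "x \<in> I" for x
    using that by (intro M.M.minus_equality) (auto simp: ideal_module_def R.l_neg)
  show ?thesis
  proof (rule M.submoduleI)
    fix x assume "x \<in> J"
    then show "\<ominus>\<^bsub>ideal_module R I\<^esub> x \<in> J"
      using assms(4) by (subst inv) auto
  qed (use assms(4) in \<open>auto simp: ideal_module_def J.I_l_closed\<close>)
qed

lemma submodule_imp_abelian_subgroup:
  assumes "module R M" "submodule N R M"
  shows "abelian_subgroup N M"
proof -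
  interpret module R M by fact
  have "subgroup N (add_monoid M)"
    using assms(2) by (simp add: submodule_def)
  then show ?thesis
    by (intro abelian_subgroupI3 additive_subgroup.intro M.abelian_group_axioms)
qed

lemma quot_module_smult_coset:
  fixes M (structure)
  assumes "module R M" "submodule N R M" "a \<in> carrier R" "x \<in> carrier M"
  shows "a \<odot>\<^bsub>quot_module M N\<^esub> (N +> x) = N +> (a \<odot> x)"
proof -
  interpret module R M by fact
  interpret N: submodule N R M by fact
  interpret A: abelian_subgroup N M
    using assms(1,2) by (rule submodule_imp_abelian_subgroup)
  have "N +> (a \<odot> y) = N +> (a \<odot> x)" if y: "y \<in> N +> x" for y
  proof -
    obtain h where h: "h \<in> N" "y = h \<oplus> x"
      using y unfolding a_r_coset_def' by blast
    have hM: "h \<in> carrier M"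
      using h(1) by (rule A.a_Hcarr)
    have "a \<odot> y = a \<odot> h \<oplus> a \<odot> x"
      using h hM assms(3,4) by (simp add: smult_r_distr)
    moreover have "a \<odot> h \<in> N"
      using assms(3) h(1) by (rule N.smult_closed)
    ultimately have "a \<odot> y \<in> N +> (a \<odot> x)"
      unfolding a_r_coset_def' by blast
    then show ?thesis
      using A.a_repr_independence'[of "a \<odot> y" "a \<odot> x"] assms(3,4) by simp
  qed
  moreover have "x \<in> N +> x"
    using assms(4) by (rule A.a_rcos_self)
  ultimately have "(\<Union>y\<in>N +> x. N +> (a \<odot> y)) = N +> (a \<odot> x)"
    by blast
  then show ?thesis
    by (simp only: quot_module_def module.simps)
qed

lemma module_quot_module:
  assumes "module R M" "submodule N R M"
  shows "module R (quot_module M N)"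
proof -
  interpret module R M by fact
  interpret N: submodule N R M by fact
  interpret A: abelian_subgroup N M
    using assms by (rule submodule_imp_abelian_subgroup)
  let ?Q = "quot_module M N"
  have carr: "carrier ?Q = (\<lambda>x. N +>\<^bsub>M\<^esub> x) ` carrier M"
    by (auto simp: quot_module_def A_RCOSETS_def')
  have add: "(N +>\<^bsub>M\<^esub> x) \<oplus>\<^bsub>?Q\<^esub> (N +>\<^bsub>M\<^esub> y) = N +>\<^bsub>M\<^esub> (x \<oplus>\<^bsub>M\<^esub> y)"
    if "x \<in> carrier M" "y \<in> carrier M" for x y
    using A.a_rcos_sum[OF that] by (simp add: quot_module_def)
  note smult = quot_module_smult_coset[OF assms]
  have zero: "\<zero>\<^bsub>?Q\<^esub> = N +>\<^bsub>M\<^esub> \<zero>\<^bsub>M\<^esub>"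
    using M.a_coset_add_zero[OF A.a_subset] by (simp add: quot_module_def)
  have Q: "abelian_group ?Q"
  proof (rule abelian_groupI)
    fix U V assume "U \<in> carrier ?Q" "V \<in> carrier ?Q"
    then show "U \<oplus>\<^bsub>?Q\<^esub> V = V \<oplus>\<^bsub>?Q\<^esub> U"
      by (auto simp: carr add M.a_comm)
  next
    fix U assume "U \<in> carrier ?Q"
    then obtain x where x: "x \<in> carrier M" "U = N +>\<^bsub>M\<^esub> x"
      unfolding carr by blast
    have "(N +>\<^bsub>M\<^esub> (\<ominus>\<^bsub>M\<^esub> x)) \<oplus>\<^bsub>?Q\<^esub> U = \<zero>\<^bsub>?Q\<^esub>"
      using x by (simp add: add zero M.l_neg)
    moreover have "N +>\<^bsub>M\<^esub> (\<ominus>\<^bsub>M\<^esub> x) \<in> carrier ?Q"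
      using x by (simp add: carr)
    ultimately show "\<exists>V\<in>carrier ?Q. V \<oplus>\<^bsub>?Q\<^esub> U = \<zero>\<^bsub>?Q\<^esub>"
      by blast
  qed (auto simp: carr add zero M.a_assoc)
  show ?thesis
  proof (rule moduleI[OF R.cring_axioms Q])
    fix a U assume "a \<in> carrier R" "U \<in> carrier ?Q"
    then show "a \<odot>\<^bsub>?Q\<^esub> U \<in> carrier ?Q"
      by (auto simp: carr add smult )
  next
    fix a b U assume "a \<in> carrier R" "b \<in> carrier R" "U \<in> carrier ?Q"
    then show "(a \<oplus>\<^bsub>R\<^esub> b) \<odot>\<^bsub>?Q\<^esub> U = a \<odot>\<^bsub>?Q\<^esub> U \<oplus>\<^bsub>?Q\<^esub> b \<odot>\<^bsub>?Q\<^esub> U"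
      by (auto simp: carr add smult smult_l_distr)
  next
    fix a U V assume "a \<in> carrier R" "U \<in> carrier ?Q" "V \<in> carrier ?Q"
    then show "a \<odot>\<^bsub>?Q\<^esub> (U \<oplus>\<^bsub>?Q\<^esub> V) = a \<odot>\<^bsub>?Q\<^esub> U \<oplus>\<^bsub>?Q\<^esub> a \<odot>\<^bsub>?Q\<^esub> V"
      by (auto simp: carr add smult smult_r_distr)
  next
    fix a b U assume "a \<in> carrier R" "b \<in> carrier R" "U \<in> carrier ?Q"
    then show "(a \<otimes>\<^bsub>R\<^esub> b) \<odot>\<^bsub>?Q\<^esub> U = a \<odot>\<^bsub>?Q\<^esub> (b \<odot>\<^bsub>?Q\<^esub> U)"
      by (auto simp: carr add smult smult_assoc1)
  next
    fix U assume "U \<in> carrier ?Q"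
    then show "\<one>\<^bsub>R\<^esub> \<odot>\<^bsub>?Q\<^esub> U = U"
      by (auto simp: carr add smult )
  qed
qed

section \<open>Polynomial rings and monomials\<close>

text \<open>
  Polynomials in variables indexed by the finite type \<open>'n\<close>, as the monoid algebra of the
  exponent vectors. A monomial is represented by its exponent vector.
\<close>

type_synonym 'n expo = "'n \<Rightarrow>\<^sub>0 nat"
type_synonym ('n, 'k) mpoly = "'n expo \<Rightarrow>\<^sub>0 'k"

abbreviation mpoly_ring :: "('n::finite, 'k::field) mpoly ring" where
  "mpoly_ring \<equiv> ring_of_type_algebra"

definition monomial :: "'n expo \<Rightarrow> ('n::finite, 'k::field) mpoly" where
  "monomial m = Poly_Mapping.single m 1"

definition total_degree :: "'n::finite expo \<Rightarrow> nat" where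
  "total_degree m = (\<Sum>i\<in>UNIV. Poly_Mapping.lookup m i)"

definition squarefree_expo :: "'n::finite expo \<Rightarrow> bool" where
  "squarefree_expo m \<longleftrightarrow> (\<forall>i. Poly_Mapping.lookup m i \<le> 1)"

definition lcm_expo :: "'n::finite expo \<Rightarrow> 'n expo \<Rightarrow> 'n expo" where
  "lcm_expo u v = Abs_poly_mapping (\<lambda>i. max (Poly_Mapping.lookup u i) (Poly_Mapping.lookup v i))"

lemma lookup_lcm_expo [simp]: "Poly_Mapping.lookup (lcm_expo u v) i = max (Poly_Mapping.lookup u i) (Poly_Mapping.lookup v i)"
  unfolding lcm_expo_def by (subst Abs_poly_mapping_inverse) simp_all

definition monomial_ideal :: "'n expo set \<Rightarrow> ('n::finite, 'k::field) mpoly set" where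
  "monomial_ideal G = Idl\<^bsub>mpoly_ring\<^esub> (monomial ` G)"

definition squarefree_monomial_ideal :: "('n::finite, 'k::field) mpoly set \<Rightarrow> bool" where
  "squarefree_monomial_ideal I \<longleftrightarrow> (\<exists>G. (\<forall>m\<in>G. squarefree_expo m) \<and> I = monomial_ideal G)"

definition minimal_monomial_generators :: "('n::finite, 'k::field) mpoly set \<Rightarrow> 'n expo set \<Rightarrow> bool" where
  "minimal_monomial_generators I G \<longleftrightarrow>
     I = monomial_ideal G \<and> (\<forall>G'. G' \<subset> G \<longrightarrow> I \<noteq> monomial_ideal G')"

definition irrelevant_ideal :: "('n::finite, 'k::field) mpoly set" where
  "irrelevant_ideal = monomial_ideal (range (\<lambda>i. Poly_Mapping.single i 1))"

definition squarefree_monomials :: "nat \<Rightarrow> ('n::finite, 'k::field) mpoly set" where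
  "squarefree_monomials k = monomial ` {m. squarefree_expo m \<and> total_degree m = k}"

end

theory Submission
  imports Defs "HOL-Library.Cardinality"
begin

text \<open>
  If \<open>I/J\<close> had depth at least \<open>d + 2\<close>, its Koszul cohomology would vanish in degrees \<open>d\<close> and
  \<open>d + 1\<close>. Let \<open>P\<close> be the set of supports of the squarefree monomials of \<open>I - J\<close>; its elements
  of size \<open>d\<close> are the supports of the \<open>f\<^sub>i\<close>. The multidegree \<open>(1, \<dots>, 1)\<close> part of the Koszul
  complex is the simplicial cochain complex of \<open>P\<close>, and the multidegree \<open>(1, \<dots>, 1) - e\<^sub>j\<close> part
  is that of the elements of \<open>P\<close> avoiding \<open>j\<close>, shifted by one. So vanishing in degree \<open>d + 1\<close>
  says, with \<open>C\<^sup>d\<close> spanned by the \<open>f\<^sub>i\<close>, that every \<open>(d + 1)\<close>-cocycle of \<open>P\<close> is a coboundary,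
  and that for each \<open>j\<close> the coboundary of the subcomplex avoiding \<open>j\<close> is injective on \<open>C\<^sup>d\<close>.

  The hypotheses on \<open>B\<close> and \<open>C\<close> force every \<open>c \<in> P\<close> of size \<open>d + 2\<close> containing some \<open>f\<^sub>i\<close> to be
  of the form \<open>g \<union> {u, v, w}\<close>, where the \<open>f\<close>'s below \<open>c\<close> are exactly \<open>g \<union> {u}\<close>, \<open>g \<union> {v}\<close>,
  \<open>g \<union> {w}\<close>. Call \<open>b \<in> P\<close> of size \<open>d + 1\<close> an edge with apex \<open>g\<close> if exactly two \<open>f\<close>'s lie
  below it and \<open>g\<close> is their intersection, and thick if there are more than two. A connected
  component \<open>V\<close> of the graph of edges with apex \<open>g\<close> carries \<open>|V| - 1\<close> independent cocycles,
  and a thick element carries one. Hence their total number \<open>N\<close> is at most \<open>r\<close>. In the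
  subcomplex avoiding \<open>j\<close> the coboundary has rank at most the sum over all \<open>V\<close> of
  \<open>|V\<^sub>j| - 1\<close> (or \<open>0\<close>), with \<open>V\<^sub>j\<close> the vertices avoiding \<open>j\<close>, plus the number of thick
  elements avoiding \<open>j\<close>. Summing over \<open>j\<close>, injectivity bounds \<open>(n - d) r\<close> by a number
  smaller than \<open>(n - d) N\<close>, a contradiction.
\<close>

section \<open>Koszul cochains\<close>

text \<open>The variables are indexed by a finite type without an order. The signs of the Koszul
  complex need one, and any injection into the naturals provides it.\<close>

definition vertex_index :: "'n::finite \<Rightarrow> nat" where
  "vertex_index = (SOME f. inj f)"

lemma inj_vertex_index: "inj (vertex_index :: 'n::finite \<Rightarrow> nat)"
proof -
  have "\<exists>f :: 'n \<Rightarrow> nat. inj f"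
    using finite_imp_inj_to_nat_seg[of "UNIV :: 'n set"] by blast
  then show ?thesis
    unfolding vertex_index_def by (rule someI_ex)
qed

text \<open>The sign of moving the basis vector of \<open>i\<close> to its place in the exterior
  product over \<open>G\<close>. The target ring is arbitrary because both polynomial and scalar
  coefficients occur.\<close>

definition insertion_sign :: "'n::finite \<Rightarrow> 'n set \<Rightarrow> 'a::comm_ring_1" where
  "insertion_sign i G = (-1) ^ card {k \<in> G. vertex_index k < vertex_index i}"

lemma insertion_sign_square [simp]: "insertion_sign i G * insertion_sign i G = 1"
  by (simp add: insertion_sign_def flip: power_mult_distrib)

lemma insertion_sign_square' [simp]: "insertion_sign i G * (insertion_sign i G * c) = c"
  by (simp flip: mult.assoc)

lemma insertion_sign_nonzero [simp]: "insertion_sign i G \<noteq> 0"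
  by (metis insertion_sign_square mult_zero_left zero_neq_one)

text \<open>Deleting the earlier of the two indices lowers the position of the later one by one,
  while deleting the later one does not move the earlier, so the two orders of deletion differ by a
  sign.\<close>

lemma insertion_sign_swap:
  assumes "i \<in> G" "j \<in> G" "i \<noteq> j"
  shows "insertion_sign i G * insertion_sign j (G - {i}) =
    - (insertion_sign j G * insertion_sign i (G - {j}) :: 'a::comm_ring_1)"
proof -
  have *: "insertion_sign i G * insertion_sign j (G - {i}) =
    - (insertion_sign j G * insertion_sign i (G - {j}) :: 'a)"
    if "i \<in> G" "j \<in> G" "vertex_index i < vertex_index j" for i j
  proof -
    let ?A = "\<lambda>G i. {k \<in> G. vertex_index k < vertex_index i}"
    have "?A (G - {j}) i = ?A G i" "?A G j = insert i (?A (G - {i}) j)" "i \<notin> ?A (G - {i}) j"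
      using that by auto
    then have "card (?A (G - {j}) i) = card (?A G i)" "card (?A G j) = Suc (card (?A (G - {i}) j))"
      by simp_all
    then show ?thesis
      by (simp add: insertion_sign_def)
  qed
  consider "vertex_index i < vertex_index j" | "vertex_index j < vertex_index i"
    using assms(3) inj_vertex_index by (metis injD nat_neq_iff)
  then show ?thesis
  proof cases
    case 1
    then show ?thesis using * assms by blast
  next
    case 2
    then show ?thesis using *[of j i] assms by (simp only: minus_minus)
  qed
qed

text \<open>Follows from \<open>insertion_sign_swap\<close> because signs are their own inverses;
  the cross terms of the homotopy formula meet in this form.\<close>

lemma insertion_sign_swap':
  assumes "i \<in> G" "j \<in> G" "i \<noteq> j"
  shows "insertion_sign i G * insertion_sign j G =
    - (insertion_sign i (G - {j}) * insertion_sign j (G - {i}) :: 'a::comm_ring_1)"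
proof -
  have "insertion_sign i G * insertion_sign j G =
     (insertion_sign i G * insertion_sign j (G - {i})) * insertion_sign j (G - {i}) * insertion_sign j G"
    by (simp add: ac_simps)
  also have "\<dots> = - (insertion_sign i (G - {j}) * insertion_sign j (G - {i}) :: 'a)"
    unfolding insertion_sign_swap[OF assms] by (simp add: ac_simps)
  finally show ?thesis .
qed

text \<open>Multiplication by the sum of the \<open>x j\<close> times e_j in the exterior algebra,
  where \<open>z G\<close> is the coefficient of the product of the e_j over \<open>G\<close>. One
  function on all subsets holds cochains of all degrees at once.\<close>

definition koszul_diff :: "('n::finite \<Rightarrow> 'a::comm_ring_1) \<Rightarrow> ('n set \<Rightarrow> 'a) \<Rightarrow> 'n set \<Rightarrow> 'a" where
  "koszul_diff x z G = (\<Sum>j\<in>G. insertion_sign j G * x j * z (G - {j}))"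

text \<open>The interior product with the functional sending e_j to \<open>s j\<close>.\<close>

definition koszul_contract :: "('n::finite \<Rightarrow> 'a::comm_ring_1) \<Rightarrow> ('n set \<Rightarrow> 'a) \<Rightarrow> 'n set \<Rightarrow> 'a" where
  "koszul_contract s z G = (\<Sum>j\<in>-G. insertion_sign j (insert j G) * s j * z (insert j G))"

lemma koszul_diff_empty [simp]: "koszul_diff x z {} = 0"
  by (simp add: koszul_diff_def)

text \<open>The terms for \<open>(i, j)\<close> and \<open>(j, i)\<close> cancel. The pairs are
  split by the order of the indices, since knowing only that the sum equals its own negative would
  not suffice in characteristic two.\<close>

lemma koszul_diff_diff: "koszul_diff x (koszul_diff x z) G = (0::'a::comm_ring_1)"
proof -
  let ?t = "\<lambda>(i, j). insertion_sign i G * insertion_sign j (G - {i}) * (x i * x j) * z (G - {i} - {j}) :: 'a"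
  let ?P = "SIGMA i:G. G - {i}"
  let ?L = "{(i, j) \<in> ?P. vertex_index i < vertex_index j}"
  let ?R = "{(i, j) \<in> ?P. vertex_index j < vertex_index i}"
  have "koszul_diff x (koszul_diff x z) G = sum ?t ?P"
    by (simp add: koszul_diff_def sum_distrib_left sum.Sigma ac_simps)
  also have "?P = ?L \<union> ?R"
  proof (intro equalityI subsetI)
    fix p assume "p \<in> ?P"
    then obtain i j where p: "p = (i, j)" "i \<in> G" "j \<in> G" "i \<noteq> j" by auto
    then have "vertex_index i \<noteq> vertex_index j"
      using injD[OF inj_vertex_index] by blast
    then show "p \<in> ?L \<union> ?R" using p by auto
  qed auto
  also have "sum ?t (?L \<union> ?R) = sum ?t ?L + sum ?t ?R"
    by (rule sum.union_disjoint) auto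
  also have "sum ?t ?R = sum (\<lambda>p. - ?t p) ?L"
  proof (rule sum.reindex_bij_witness[of _ "\<lambda>(i, j). (j, i)" "\<lambda>(i, j). (j, i)"], goal_cases)
    case (5 p)
    then obtain i j where p: "p = (i, j)" "i \<in> G" "j \<in> G" "i \<noteq> j" by auto
    have "G - {i} - {j} = G - {j} - {i}" by auto
    then show ?case
      using arg_cong[OF insertion_sign_swap[of i G j, where ?'a='a],
          of "\<lambda>c. c * (x i * x j * z (G - {i} - {j}))"] p
      by (simp add: ac_simps)
  qed auto
  finally show ?thesis
    by (simp add: sum_negf)
qed

text \<open>Cartan's formula: exchanging one index for a different one in the two possible orders
  gives opposite signs. What survives inserts and removes the same index; one composite contributes
  the indices in \<open>G\<close>, the other those outside.\<close>

lemma koszul_homotopy: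
  "koszul_diff x (koszul_contract s z) G + koszul_contract s (koszul_diff x z) G
   = (\<Sum>j\<in>UNIV. s j * x j) * (z G :: 'a::comm_ring_1)"
proof -
  let ?u = "\<lambda>j k. insertion_sign j G * insertion_sign k (insert k (G - {j})) * (x j * s k) * z (insert k (G - {j}))"
  let ?v = "\<lambda>k j. insertion_sign k (insert k G) * insertion_sign j (insert k G) * (x j * s k) * z (insert k G - {j})"
  have uv: "?v k j = - ?u j k" if "j \<in> G" "k \<notin> G" for j k
  proof -
    have "insert k G - {k} = G" "insert k G - {j} = insert k (G - {j})" "j \<noteq> k"
      using that by auto
    then show ?thesis
      using insertion_sign_swap'[of k "insert k G" j, where ?'a='a] that
      by (simp add: ac_simps)
  qed
  have "koszul_diff x (koszul_contract s z) G = (\<Sum>j\<in>G. \<Sum>k\<in>-(G - {j}). ?u j k)"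
    unfolding koszul_diff_def koszul_contract_def sum_distrib_left
    by (intro sum.cong refl) (simp only: ac_simps)
  also have "\<dots> = (\<Sum>j\<in>G. s j * x j * z G + (\<Sum>k\<in>-G. ?u j k))"
  proof (rule sum.cong[OF refl])
    fix j assume j: "j \<in> G"
    have "-(G - {j}) = insert j (-G)" "insert j (G - {j}) = G"
      using j by auto
    then show "(\<Sum>k\<in>-(G - {j}). ?u j k) = s j * x j * z G + (\<Sum>k\<in>-G. ?u j k)"
      using j by (simp add: algebra_simps)
  qed
  also have "\<dots> = (\<Sum>j\<in>G. s j * x j * z G) + (\<Sum>j\<in>G. \<Sum>k\<in>-G. ?u j k)"
    by (rule sum.distrib)
  finally have 1: "koszul_diff x (koszul_contract s z) G
      = (\<Sum>j\<in>G. s j * x j * z G) + (\<Sum>j\<in>G. \<Sum>k\<in>-G. ?u j k)"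
    by (simp add: sum.distrib)
  have "koszul_contract s (koszul_diff x z) G = (\<Sum>k\<in>-G. \<Sum>j\<in>insert k G. ?v k j)"
    unfolding koszul_diff_def koszul_contract_def sum_distrib_left
    by (intro sum.cong refl) (simp only: ac_simps)
  also have "\<dots> = (\<Sum>k\<in>-G. s k * x k * z G + (\<Sum>j\<in>G. - ?u j k))"
  proof (rule sum.cong[OF refl])
    fix k assume k: "k \<in> -G"
    have "(\<Sum>j\<in>insert k G. ?v k j) = ?v k k + (\<Sum>j\<in>G. ?v k j)"
      using k by simp
    also have "?v k k = s k * x k * z G"
      using k by (simp add: ac_simps)
    also have "(\<Sum>j\<in>G. ?v k j) = (\<Sum>j\<in>G. - ?u j k)"
      using k by (intro sum.cong refl uv) auto
    finally show "(\<Sum>j\<in>insert k G. ?v k j) = s k * x k * z G + (\<Sum>j\<in>G. - ?u j k)" .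
  qed
  also have "\<dots> = (\<Sum>k\<in>-G. s k * x k * z G) - (\<Sum>k\<in>-G. \<Sum>j\<in>G. ?u j k)"
    by (simp add: sum.distrib sum_negf sum_subtractf)
  also have "(\<Sum>k\<in>-G. \<Sum>j\<in>G. ?u j k) = (\<Sum>j\<in>G. \<Sum>k\<in>-G. ?u j k)"
    by (rule sum.swap)
  finally have 2: "koszul_contract s (koszul_diff x z) G
      = (\<Sum>k\<in>-G. s k * x k * z G) - (\<Sum>j\<in>G. \<Sum>k\<in>-G. ?u j k)" .
  have "(\<Sum>j\<in>G. s j * x j * z G) + (\<Sum>k\<in>-G. s k * x k * z G) = (\<Sum>j\<in>UNIV. s j * x j * z G)"
    using sum.union_disjoint[of G "-G" "\<lambda>j. s j * x j * z G"] by simp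
  then show ?thesis
    by (simp add: 1 2 sum_distrib_right)
qed

section \<open>Vanishing of Koszul cohomology along a regular sequence\<close>

definition ideal_set :: "'a::comm_ring_1 set \<Rightarrow> bool" where
  "ideal_set N \<longleftrightarrow> 0 \<in> N \<and> (\<forall>a\<in>N. \<forall>b\<in>N. a + b \<in> N) \<and> (\<forall>a\<in>N. \<forall>c. c * a \<in> N)"

lemma ideal_setD:
  assumes "ideal_set N"
  shows "0 \<in> N" "a \<in> N \<Longrightarrow> b \<in> N \<Longrightarrow> a + b \<in> N" "a \<in> N \<Longrightarrow> c * a \<in> N"
    "a \<in> N \<Longrightarrow> - a \<in> N" "a \<in> N \<Longrightarrow> b \<in> N \<Longrightarrow> a - b \<in> N"
proof -
  show "0 \<in> N" "a \<in> N \<Longrightarrow> b \<in> N \<Longrightarrow> a + b \<in> N" and c: "\<And>a c. a \<in> N \<Longrightarrow> c * a \<in> N"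
    using assms by (auto simp: ideal_set_def)
  show m: "- a \<in> N" if "a \<in> N" for a using c[OF that, of "-1"] by simp
  show "a - b \<in> N" if "a \<in> N" "b \<in> N"
    using m[OF that(2)] that(1) assms unfolding ideal_set_def diff_conv_add_uminus by blast
qed

lemma ideal_set_sum:
  assumes "ideal_set N" "\<And>i. i \<in> A \<Longrightarrow> h i \<in> N"
  shows "sum h A \<in> N"
  using assms(2) by (induction A rule: infinite_finite_induct) (auto intro: ideal_setD[OF assms(1)])

lemma koszul_diff_in:
  assumes "ideal_set N" "\<And>j. j \<in> G \<Longrightarrow> z (G - {j}) \<in> N"
  shows "koszul_diff x z G \<in> N"
  unfolding koszul_diff_def by (intro ideal_set_sum ideal_setD[OF assms(1)] assms)

lemma koszul_contract_in:
  assumes "ideal_set N" "\<And>j. j \<notin> G \<Longrightarrow> z (insert j G) \<in> N"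
  shows "koszul_contract s z G \<in> N"
  unfolding koszul_contract_def by (rule ideal_set_sum) (auto intro: ideal_setD[OF assms(1)] assms)

lemma koszul_diff_cong:
  assumes "\<And>j. j \<in> G \<Longrightarrow> z (G - {j}) = w (G - {j})"
  shows "koszul_diff x z G = koszul_diff x w G"
  unfolding koszul_diff_def by (intro sum.cong refl) (simp add: assms)

lemma koszul_diff_add: "koszul_diff x (\<lambda>G. z G + w G) G = koszul_diff x z G + koszul_diff x w G"
  by (simp add: koszul_diff_def sum.distrib algebra_simps)

lemma koszul_diff_mult: "koszul_diff x (\<lambda>G. c * z G) G = c * koszul_diff x z G"
  by (simp add: koszul_diff_def sum_distrib_left algebra_simps)

text \<open>
  The Koszul cohomology of \<open>I / N m\<close>, in which \<open>y m, y (m + 1), \<dots>\<close> is a regular sequence: if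
  \<open>z\<close> is a cocycle, then \<open>y m * z\<close> is the coboundary of the contraction of \<open>z\<close>, which is a
  cocycle of degree one less modulo \<open>N (m + 1)\<close>.
\<close>

lemma koszul_vanishing:
  fixes x :: "'n::finite \<Rightarrow> 'a::comm_ring_1" and N :: "nat \<Rightarrow> 'a set"
  assumes I: "ideal_set I" and N: "\<And>m. ideal_set (N m)"
    and NI: "\<And>m. N m \<subseteq> I"
    and N_Suc: "\<And>m. N (Suc m) = {u + y m * v | u v. u \<in> N m \<and> v \<in> I}"
    and y: "\<And>m. m < k \<Longrightarrow> y m = (\<Sum>j\<in>UNIV. s m j * x j)"
    and reg: "\<And>m v. m < k \<Longrightarrow> v \<in> I \<Longrightarrow> y m * v \<in> N m \<Longrightarrow> v \<in> N m"
    and "m + i < k" and zI: "\<And>G. z G \<in> I"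
    and dz: "\<And>G. card G = Suc i \<Longrightarrow> koszul_diff x z G \<in> N m"
  shows "\<exists>u. (\<forall>G. u G \<in> I) \<and> (\<forall>G. card G = i \<longrightarrow> z G - koszul_diff x u G \<in> N m)"
  using assms(7-)
proof (induction i arbitrary: m z)
  case 0
  \<comment> \<open>A coboundary is zero at the empty set, so the homotopy formula there reads: this
    contraction equals \<open>y m * z {}\<close>.\<close>
  have "koszul_contract (s m) (koszul_diff x z) {} \<in> N m"
    by (intro koszul_contract_in N 0) auto
  then have "y m * z {} \<in> N m"
    using koszul_homotopy[of x "s m" z "{}"] y[of m] 0 by simp
  then have "z {} \<in> N m"
    using reg[of m "z {}"] 0 by simp
  then show ?case
    using ideal_setD[OF I] by (intro exI[of _ "\<lambda>_. 0"]) simp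
next
  case (Suc i)
  note C = Suc.prems
  let ?w = "koszul_contract (s m) z"
  have h: "koszul_contract (s m) (koszul_diff x z) G \<in> N m" if "card G = Suc i" for G
    using that by (intro koszul_contract_in N C) auto
  have yz: "koszul_diff x ?w G + koszul_contract (s m) (koszul_diff x z) G = y m * z G" for G
    using koszul_homotopy[of x "s m" z G] y[of m] C by simp
  have "koszul_diff x ?w G \<in> N (Suc m)" if "card G = Suc i" for G
  proof -
    have "koszul_diff x ?w G = - koszul_contract (s m) (koszul_diff x z) G + y m * z G"
      using yz[of G] by (simp add: algebra_simps)
    then show ?thesis
      unfolding N_Suc using ideal_setD(4)[OF N h[OF that]] C(2) by blast
  qed
  moreover have "?w G \<in> I" for G
    by (intro koszul_contract_in I C)
  ultimately obtain v where v: "\<And>G. v G \<in> I" "\<And>G. card G = i \<Longrightarrow> ?w G - koszul_diff x v G \<in> N (Suc m)"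
    using Suc.IH[of "Suc m" ?w] C(1) by auto
  \<comment> \<open>Membership is demanded for every \<open>G\<close>, with zero as the value at
    sets of the wrong size, because the claim asks for \<open>u G\<close> in \<open>I\<close>
    throughout.\<close>
  have "\<forall>G. \<exists>n u. n \<in> N m \<and> u \<in> I \<and> (card G = i \<longrightarrow> ?w G - koszul_diff x v G = n + y m * u)"
    using v(2) ideal_setD(1)[OF I] ideal_setD(1)[OF N] unfolding N_Suc by blast
  then obtain n u where nu: "\<And>G. n G \<in> N m" "\<And>G. u G \<in> I"
      "\<And>G. card G = i \<Longrightarrow> ?w G - koszul_diff x v G = n G + y m * u G"
    by metis
  \<comment> \<open>Multiplied by \<open>y m\<close>, the difference becomes the coboundary of
    \<open>n\<close> plus the contraction of the coboundary of \<open>z\<close>, both in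
    \<open>N m\<close>; the contribution of \<open>v\<close> dies as the differential squares to
    zero. Regularity then cancels \<open>y m\<close>.\<close>
  have "z G - koszul_diff x u G \<in> N m" if G: "card G = Suc i" for G
  proof (rule reg)
    have "koszul_diff x ?w G = koszul_diff x (\<lambda>G. koszul_diff x v G + (n G + y m * u G)) G"
      using G by (intro koszul_diff_cong) (simp add: nu(3)[symmetric])
    also have "\<dots> = koszul_diff x n G + y m * koszul_diff x u G"
      by (simp add: koszul_diff_add koszul_diff_mult koszul_diff_diff)
    finally have "y m * (z G - koszul_diff x u G)
        = koszul_diff x n G + koszul_contract (s m) (koszul_diff x z) G"
      using yz[of G] by (simp add: algebra_simps)
    then show "y m * (z G - koszul_diff x u G) \<in> N m"
      using h[OF G] ideal_setD(2)[OF N koszul_diff_in[OF N nu(1)]] by simp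
    show "z G - koszul_diff x u G \<in> I"
      by (intro ideal_setD(5)[OF I] C koszul_diff_in[OF I] nu)
  qed (use C in simp)
  then show ?case
    using nu(2) by blast
qed

section \<open>Counting in the poset of squarefree monomials\<close>

text \<open>Gaussian elimination, one equation at a time: a zero equation is dropped, any other one
  eliminates an unknown \<open>p\<close>. Solutions vanish outside \<open>U\<close> so that they are
  cochains with prescribed support.\<close>

lemma homogeneous_system_nontrivial_solution:
  fixes A :: "'e \<Rightarrow> 'i \<Rightarrow> 'k::field"
  assumes "finite E" "finite U" "card E < card U"
  shows "\<exists>x. (\<forall>i. x i \<noteq> 0 \<longrightarrow> i \<in> U) \<and> (\<exists>i. x i \<noteq> 0) \<and> (\<forall>e\<in>E. (\<Sum>i\<in>U. A e i * x i) = 0)"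
  using assms
proof (induction E arbitrary: U A rule: finite_induct)
  case empty
  then obtain i where "i \<in> U" by fastforce
  then show ?case by (intro exI[of _ "\<lambda>k. if k = i then 1 else 0"]) auto
next
  case (insert e E)
  show ?case
  proof (cases "\<forall>i\<in>U. A e i = 0")
    case True
    have "card E < card U" using insert by simp
    from insert.IH[OF insert.prems(1) this, of A] True show ?thesis by auto
  next
    case False
    then obtain p where p: "p \<in> U" "A e p \<noteq> 0" by blast
    let ?U = "U - {p}"
    let ?B = "\<lambda>e' i. A e' i - A e' p * A e i / A e p"
    have "card E < card ?U" using insert p by simp
    from insert.IH[OF finite_Diff[OF insert.prems(1)] this, of ?B]
    obtain x where x: "\<And>i. x i \<noteq> 0 \<Longrightarrow> i \<in> ?U" "\<exists>i. x i \<noteq> 0"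
        "\<And>e'. e' \<in> E \<Longrightarrow> (\<Sum>i\<in>?U. ?B e' i * x i) = 0"
      by blast
    \<comment> \<open>The value at \<open>p\<close> is the one that solves equation
      \<open>e\<close>; the coefficients \<open>?B\<close> were reduced so that the other equations
      then hold as well.\<close>
    let ?y = "x(p := - (\<Sum>i\<in>?U. A e i * x i) / A e p)"
    have expand: "(\<Sum>i\<in>U. A e' i * ?y i) = A e' p * ?y p + (\<Sum>i\<in>?U. A e' i * x i)" for e'
      using p insert.prems(1) by (simp add: sum.remove[of U p])
    have "(\<Sum>i\<in>U. A e' i * ?y i) = 0" if "e' \<in> insert e E" for e'
    proof (cases "e' = e")
      case True
      then show ?thesis unfolding expand using p True by simp
    next
      case False
      then have "0 = (\<Sum>i\<in>?U. ?B e' i * x i)" using that x(3) by simp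
      also have "\<dots> = (\<Sum>i\<in>?U. A e' i * x i) - A e' p / A e p * (\<Sum>i\<in>?U. A e i * x i)"
        by (simp add: left_diff_distrib sum_subtractf sum_distrib_left mult.assoc)
      finally show ?thesis unfolding expand by simp
    qed
    moreover have "?y i \<noteq> 0 \<Longrightarrow> i \<in> U" for i
      using x(1)[of i] p by (auto split: if_splits)
    moreover have "\<exists>i. ?y i \<noteq> 0"
      using x(1,2) by (metis DiffD2 fun_upd_other singletonI)
    ultimately show ?thesis by blast
  qed
qed

section \<open>Simplicial cochains with values in the field\<close>

definition coboundary :: "('n::finite set \<Rightarrow> 'k::field) \<Rightarrow> 'n set \<Rightarrow> 'k" where
  "coboundary x = koszul_diff (\<lambda>_. 1) x"

lemma coboundary_eq: "coboundary x b = (\<Sum>i\<in>b. insertion_sign i b * x (b - {i}))"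
  by (simp add: coboundary_def koszul_diff_def)

lemma coboundary_eq_0: "(\<And>i. i \<in> b \<Longrightarrow> x (b - {i}) = 0) \<Longrightarrow> coboundary x b = 0"
  by (simp add: coboundary_eq)

lemma coboundary_sum: "coboundary (\<lambda>t. \<Sum>a\<in>S. c a * x a t) b = (\<Sum>a\<in>S. c a * coboundary (x a) b)"
  unfolding coboundary_eq sum_distrib_left
  by (subst sum.swap) (simp add: ac_simps)

abbreviation unit_cochain :: "'n set \<Rightarrow> 'n set \<Rightarrow> 'k::field" where
  "unit_cochain t \<equiv> (\<lambda>s. if s = t then 1 else 0)"

text \<open>Coboundaries of unit cochains are the columns of the matrix of the coboundary; this
  turns its vanishing into a linear system in the values of \<open>x\<close>.\<close>

lemma coboundary_expand:
  assumes "finite U" "\<And>t. x t \<noteq> 0 \<Longrightarrow> t \<in> U"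
  shows "(\<Sum>t\<in>U. coboundary (unit_cochain t) b * x t) = coboundary x b"
proof -
  have *: "(\<Sum>t\<in>U. x t * unit_cochain t s) = x s" for s
    using assms by (auto simp: if_distrib[of "\<lambda>c. _ * c"] sum.delta' cong: if_cong)
  have "(\<Sum>t\<in>U. coboundary (unit_cochain t) b * x t) = coboundary (\<lambda>s. \<Sum>t\<in>U. x t * unit_cochain t s) b"
    unfolding coboundary_sum by (simp only: mult.commute)
  then show ?thesis by (simp only: *)
qed

definition pick :: "'a set \<Rightarrow> 'a" where "pick S = (SOME s. s \<in> S)"

lemma pick_in: "S \<noteq> {} \<Longrightarrow> pick S \<in> S"
  unfolding pick_def by (rule someI_ex) auto

text \<open>For the empty set both sides are zero by truncated subtraction, which is the right count
  for a component without a vertex avoiding a given index.\<close>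

lemma card_minus_pick: "card (S - {pick S}) = card S - 1"
  by (cases "S = {}") (simp_all add: pick_in)

lemma subset_codim_one:
  assumes "s \<subseteq> b" "card b = Suc (card s)" "finite b"
  obtains v where "v \<in> b" "s = b - {v}"
proof -
  have "card (b - s) = 1" using assms by (simp add: card_Diff_subset finite_subset)
  then obtain v where "b - s = {v}" by (auto simp: card_1_singleton_iff)
  then show thesis using assms(1) by (intro that[of v]) auto
qed

lemma card_Compl: "card (- A) = CARD('n) - card (A :: 'n::finite set)"
  by (simp add: Compl_eq_Diff_UNIV card_Diff_subset)

text \<open>Double counting of the pairs of an index and a member of \<open>V\<close> avoiding
  it.\<close>

lemma sum_card_avoiding:
  "(\<Sum>j\<in>UNIV. card {t \<in> V. j \<notin> t}) = (\<Sum>t\<in>V. CARD('n) - card (t :: 'n::finite set))"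
proof -
  have "(\<Sum>j\<in>UNIV. card {t \<in> V. j \<notin> t}) = (\<Sum>t\<in>V. card {j \<in> UNIV. j \<notin> t})"
    by (rule sum_multicount_gen) auto
  also have "\<dots> = (\<Sum>t\<in>V. CARD('n) - card t)"
    by (intro sum.cong refl) (simp add: card_Compl Collect_neg_eq)
  finally show ?thesis .
qed

text \<open>Abstracts the supports of the squarefree monomials of \<open>I - J\<close>. The
  condition on \<open>B\<close> yields \<open>another_face\<close>, the one on \<open>C\<close>
  yields \<open>no_join\<close>, and \<open>convex\<close> reflects that both ideals are closed
  under multiples.\<close>

locale level_poset =
  fixes P :: "'n::finite set set" and d :: nat
  assumes convex: "A \<in> P \<Longrightarrow> C \<in> P \<Longrightarrow> A \<subseteq> B \<Longrightarrow> B \<subseteq> C \<Longrightarrow> B \<in> P"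
    and another_face: "b \<in> P \<Longrightarrow> card b = Suc d \<Longrightarrow> t \<in> P \<Longrightarrow> card t = d \<Longrightarrow> t \<subseteq> b
      \<Longrightarrow> \<exists>t'\<in>P. card t' = d \<and> t' \<subseteq> b \<and> t' \<noteq> t"
    and no_join: "s \<in> P \<Longrightarrow> card s = d \<Longrightarrow> t \<in> P \<Longrightarrow> card t = d \<Longrightarrow> card (s \<union> t) = d + 2 \<Longrightarrow> s \<union> t \<notin> P"
begin

definition bottom :: "'n set set" where "bottom = {t \<in> P. card t = d}"

definition faces :: "'n set \<Rightarrow> 'n set set" where "faces b = {t \<in> bottom. t \<subseteq> b}"

definition edges :: "'n set \<Rightarrow> 'n set set" where
  "edges g = {b \<in> P. card b = Suc d \<and> card (faces b) = 2 \<and> \<Inter>(faces b) = g}"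

definition thick :: "'n set set" where
  "thick = {b \<in> P. card b = Suc d \<and> card (faces b) > 2}"

definition adj :: "'n set \<Rightarrow> 'n set rel" where
  "adj g = {(s, t). \<exists>b\<in>edges g. s \<in> faces b \<and> t \<in> faces b}"

definition component :: "'n set \<Rightarrow> 'n set \<Rightarrow> 'n set set" where
  "component g t = (adj g)\<^sup>* `` {t}"

text \<open>The apex is recorded because one vertex set, such as a single vertex, can be a component
  for several apexes.\<close>

definition blocks :: "('n set \<times> 'n set set) set" where
  "blocks = {(g, component g t) | g t. t \<in> bottom}"

lemma edge_two_faces:
  assumes "s \<in> faces b" "t \<in> faces b" "s \<noteq> t" "card b = Suc d"
  obtains g u v where "u \<notin> g" "v \<notin> g" "u \<noteq> v" "b = insert u (insert v g)"
    "s = insert u g" "t = insert v g" "g = s \<inter> t"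
proof -
  obtain v where v: "v \<in> b" "s = b - {v}"
    using assms subset_codim_one[of s b] by (auto simp: faces_def bottom_def)
  obtain u where u: "u \<in> b" "t = b - {u}"
    using assms subset_codim_one[of t b] by (auto simp: faces_def bottom_def)
  show thesis
    by (rule that[of u "b - {u, v}" v]) (use u v assms(3) in auto)
qed

lemma edgesE:
  assumes "b \<in> edges g"
  obtains u v where "u \<notin> g" "v \<notin> g" "u \<noteq> v" "b = insert u (insert v g)"
    "faces b = {insert u g, insert v g}" "Suc (card g) = d" "b \<in> P" "card b = Suc d"
proof -
  obtain s t where st: "faces b = {s, t}" "s \<noteq> t"
    using assms by (auto simp: edges_def card_2_iff)
  then have g: "g = s \<inter> t" using assms by (auto simp: edges_def)
  have b: "b \<in> P" "card b = Suc d" using assms by (auto simp: edges_def)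
  have "s \<in> faces b" "t \<in> faces b" using st by auto
  from edge_two_faces[OF this st(2) b(2)]
  obtain u v where uv: "u \<notin> g" "v \<notin> g" "u \<noteq> v" "b = insert u (insert v g)"
    "s = insert u g" "t = insert v g"
    unfolding g by metis
  show thesis
    by (rule that[OF uv(1-4)]) (use uv st b in auto)
qed

lemma edges_disjoint: "b \<in> edges g \<Longrightarrow> b \<in> edges g' \<Longrightarrow> g = g'"
  by (auto simp: edges_def)

text \<open>By \<open>another_face\<close> a single face is impossible.\<close>

lemma edge_or_thick:
  assumes "b \<in> P" "card b = Suc d" "faces b \<noteq> {}"
  shows "b \<in> thick \<or> (\<exists>g. b \<in> edges g)"
proof -
  obtain t where t: "t \<in> faces b" using assms by auto
  then obtain t' where t': "t' \<in> faces b" "t' \<noteq> t"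
    using another_face[of b t] assms by (auto simp: faces_def bottom_def)
  have "card {t, t'} \<le> card (faces b)" using t t' by (intro card_mono) auto
  then show ?thesis using assms t' by (auto simp: thick_def edges_def)
qed

text \<open>One element below \<open>c\<close> with a face supplies the faces
  \<open>insert u g\<close> and \<open>insert v g\<close>. With \<open>w\<close> the remaining point
  of \<open>c\<close>, \<open>no_join\<close> forces \<open>insert w g\<close> to be a face and
  forbids any fourth. Every \<open>b\<close> in question then contains exactly two of the three, and
  these meet in \<open>g\<close>.\<close>

lemma common_apex:
  assumes c: "c \<in> P" "card c = d + 2"
  shows "\<exists>g. \<forall>b\<in>P. b \<subseteq> c \<longrightarrow> card b = Suc d \<longrightarrow> faces b \<noteq> {} \<longrightarrow> b \<in> edges g"
proof (cases "\<exists>b\<in>P. b \<subseteq> c \<and> card b = Suc d \<and> faces b \<noteq> {}")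
  case False
  then show ?thesis by blast
next
  case True
  then obtain b t where b: "b \<in> P" "b \<subseteq> c" "card b = Suc d" "t \<in> faces b" by blast
  then obtain t' where t': "t' \<in> faces b" "t' \<noteq> t"
    using another_face[of b t] by (auto simp: faces_def bottom_def)
  obtain g u v where uv: "u \<notin> g" "v \<notin> g" "u \<noteq> v" "b = insert u (insert v g)"
    "t = insert u g" "t' = insert v g"
    using edge_two_faces[OF b(4) t'(1) t'(2)[symmetric] b(3)] by metis
  obtain w where w: "w \<in> c" "b = c - {w}"
    using subset_codim_one[of b c] b c by auto
  have cw: "c = insert w b" "w \<notin> g" "w \<noteq> u" "w \<noteq> v" using w uv by auto
  have T: "s \<in> P" "card s = d" if "s \<in> faces c" for s
    using that by (auto simp: faces_def bottom_def)
  have join: "s \<union> s' \<noteq> c" if "s \<in> faces c" "s' \<in> faces c" for s s'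
    using no_join[of s s'] T[OF that(1)] T[OF that(2)] c by auto
  have tc: "t \<in> faces c" "t' \<in> faces c" using b t' w by (auto simp: faces_def)
  \<comment> \<open>This set lies between the face \<open>t\<close> and \<open>c\<close>; containing
    one face, it must contain another.\<close>
  have "insert w t \<in> P"
    by (rule convex[of t c]) (use T tc c uv cw in auto)
  moreover have "card (insert w t) = Suc d" using T tc uv cw by auto
  ultimately obtain s where s: "s \<in> P" "card s = d" "s \<subseteq> insert w t" "s \<noteq> t"
    using another_face[of "insert w t" t] T tc by blast
  then have sc: "s \<in> faces c" using uv cw by (auto simp: faces_def bottom_def)
  obtain u' where u': "u' \<in> insert w t" "s = insert w t - {u'}"
    using subset_codim_one[of s "insert w t"] s \<open>card (insert w t) = Suc d\<close> by auto
  have "u' \<noteq> w" using u' s uv cw by auto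
  \<comment> \<open>Otherwise \<open>u'\<close> lies in \<open>g\<close>, and \<open>s\<close>
    together with \<open>t'\<close> would fill \<open>c\<close>.\<close>
  have "u' = u"
  proof (rule ccontr)
    assume "u' \<noteq> u"
    then have "s \<union> t' = c" using u' \<open>u' \<noteq> w\<close> uv cw by auto
    then show False using join sc tc by blast
  qed
  then have sw: "s = insert w g" using u' uv cw by auto
  have fc: "\<exists>y\<in>{u, v, w}. a = insert y g" if a: "a \<in> faces c" for a
  proof -
    have "card (c - a) = 2" using T[OF a] c a by (simp add: card_Diff_subset faces_def)
    then obtain p q where pq: "c - a = {p, q}" by (auto simp: card_2_iff)
    \<comment> \<open>If \<open>a\<close> missed a point of \<open>g\<close>, one of the three known
      faces would contain both points missing from \<open>a\<close>, and its union with
      \<open>a\<close> would be \<open>c\<close>.\<close>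
    have "e \<notin> g" if e: "c - a = {e, h}" for e h
    proof
      assume "e \<in> g"
      moreover obtain y where "y \<in> {u, v, w}" "h \<in> insert y g"
        using e uv cw by blast
      ultimately have "a \<union> insert y g = c" using e uv cw a by (auto simp: faces_def)
      moreover have "insert y g \<in> faces c" using \<open>y \<in> _\<close> sc sw tc uv by auto
      ultimately show False using join a by blast
    qed
    from this[OF pq] this[of q p] pq have "p \<notin> g" "q \<notin> g" by (auto simp: insert_commute)
    then have "{p, q} \<subseteq> {u, v, w}" using pq uv cw by blast
    moreover have "p \<noteq> q" using \<open>card (c - a) = 2\<close> pq by auto
    moreover have "a = c - {p, q}" using pq a by (auto simp: faces_def)
    ultimately show ?thesis using uv cw by auto
  qed
  have "b' \<in> edges g" if b': "b' \<in> P" "b' \<subseteq> c" "card b' = Suc d" "faces b' \<noteq> {}" for b'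
  proof -
    obtain a where a: "a \<in> faces b'" using b' by auto
    obtain a' where a': "a' \<in> faces b'" "a' \<noteq> a"
      using another_face[of b' a] a b' by (auto simp: faces_def bottom_def)
    have sub: "faces b' \<subseteq> faces c" using b' by (auto simp: faces_def)
    obtain y where y: "y \<in> {u, v, w}" "a = insert y g" using fc a sub by blast
    obtain y' where y': "y' \<in> {u, v, w}" "a' = insert y' g" using fc a' sub by blast
    have ne: "y \<noteq> y'" "y \<notin> g" "y' \<notin> g" using a' y y' uv cw by auto
    obtain z where z: "b' = c - {z}" "z \<in> c"
      using subset_codim_one[of b' c] b' c by auto
    have b'eq: "b' = insert y (insert y' g)"
    proof -
      have "insert y (insert y' g) \<subseteq> b'" using a a' y y' by (auto simp: faces_def)
      moreover have "Suc (card g) = d" using T[of t] tc uv by auto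
      then have "card (insert y (insert y' g)) = card b'" using ne b' by auto
      ultimately show ?thesis by (metis card_subset_eq finite)
    qed
    have "faces b' = {a, a'}"
    proof (intro equalityI subsetI)
      fix e assume e: "e \<in> faces b'"
      then obtain x where x: "x \<in> {u, v, w}" "e = insert x g" using fc sub by blast
      then have "x \<in> {y, y'}" using e b'eq uv cw by (auto simp: faces_def)
      then show "e \<in> {a, a'}" using x y y' by auto
    qed (use a a' in auto)
    then show ?thesis using b' a' ne y y' by (auto simp: edges_def)
  qed
  then show ?thesis by blast
qed

text \<open>By \<open>common_apex\<close>, anything with a face below \<open>c\<close> is an edge.
  Hence the unit cochain at a thick element is a cocycle.\<close>

lemma thick_not_below:
  assumes "b \<in> thick" "c \<in> P" "card c = d + 2" shows "\<not> b \<subseteq> c"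
proof
  assume "b \<subseteq> c"
  moreover have "faces b \<noteq> {}" using assms(1) by (auto simp: thick_def)
  ultimately obtain g where "b \<in> edges g"
    using common_apex[OF assms(2,3)] assms(1) by (auto simp: thick_def)
  then show False using assms(1) by (auto simp: edges_def thick_def)
qed

text \<open>
  Twisting by this sign turns the coboundary on the edges with apex \<open>g\<close> into the coboundary of a graph
  with vertices the \<open>f\<close>'s. The argument of \<^const>\<open>the_elem\<close> is a singleton for every vertex of an edge.
\<close>

definition orient :: "'n set \<Rightarrow> 'n set \<Rightarrow> 'k::field" where
  "orient g t = insertion_sign (the_elem (t - g)) t"

text \<open>Only two terms of the coboundary survive, as an edge has two faces and \<open>x\<close>
  lives on \<open>bottom\<close>. Up to a sign, \<open>orient\<close> makes them a
  difference.\<close>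

lemma coboundary_edge:
  fixes x :: "'n set \<Rightarrow> 'k::field"
  assumes b: "b \<in> edges g" and x: "\<And>t. x t \<noteq> 0 \<Longrightarrow> t \<in> bottom"
  shows "coboundary x b = 0 \<longleftrightarrow> (\<forall>s\<in>faces b. \<forall>t\<in>faces b. orient g s * x s = orient g t * x t)"
proof -
  obtain u v where uv: "u \<notin> g" "v \<notin> g" "u \<noteq> v" "b = insert u (insert v g)"
    "faces b = {insert u g, insert v g}" "Suc (card g) = d" "card b = Suc d" using edgesE[OF b] by metis
  have "x (b - {i}) = 0" if "i \<in> g" for i
  proof (rule ccontr)
    assume "x (b - {i}) \<noteq> 0"
    then have "b - {i} \<in> faces b" using x by (auto simp: faces_def)
    then show False using uv that by auto
  qed
  then have "(\<Sum>i\<in>g. insertion_sign i b * x (b - {i})) = 0" by simp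
  moreover have "b - {u} = insert v g" "b - {v} = insert u g" using uv by auto
  ultimately have cb: "coboundary x b = insertion_sign u b * x (insert v g) + insertion_sign v b * x (insert u g)"
    using uv(1-3) unfolding coboundary_eq by (simp add: uv(4))
  have o: "orient g (insert u g) = (insertion_sign u (insert u g) :: 'k)"
    "orient g (insert v g) = (insertion_sign v (insert v g) :: 'k)"
    using uv by (simp_all add: orient_def insert_Diff_if)
  let ?c = "insertion_sign v b * insertion_sign u (insert u g) :: 'k"
  have sw: "insertion_sign u b * insertion_sign v (insert v g) = - ?c"
    using insertion_sign_swap[of u b v, where ?'a='k] uv \<open>b - {u} = _\<close> \<open>b - {v} = _\<close> by simp
  have "coboundary x b = ?c * (orient g (insert u g) * x (insert u g))
      + insertion_sign u b * insertion_sign v (insert v g) * (orient g (insert v g) * x (insert v g))"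
    by (simp add: cb o ac_simps)
  also have "\<dots> = ?c * (orient g (insert u g) * x (insert u g) - orient g (insert v g) * x (insert v g))"
    by (simp add: sw algebra_simps)
  finally show ?thesis by (auto simp: uv(5))
qed

section \<open>Components of the graphs and their vertex counts\<close>

lemma sym_adj: "sym (adj g)"
  by (auto simp: sym_def adj_def)

lemma component_refl: "t \<in> component g t"
  by (simp add: component_def)

lemma component_eq:
  assumes "s \<in> component g t" shows "component g s = component g t"
proof -
  have st: "(t, s) \<in> (adj g)\<^sup>*" using assms by (simp add: component_def)
  moreover have "(s, t) \<in> (adj g)\<^sup>*"
    using symD[OF sym_rtrancl[OF sym_adj] st] .
  ultimately show ?thesis
    unfolding component_def by (auto intro: rtrancl_trans)
qed

lemma component_adj:
  assumes "b \<in> edges g" "s \<in> faces b" "t \<in> faces b"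
  shows "s \<in> component g t"
  using assms by (auto simp: component_def adj_def)

lemma component_bottom:
  assumes "t \<in> bottom" "s \<in> component g t" shows "s \<in> bottom"
proof -
  have "(t, s) \<in> (adj g)\<^sup>*" using assms by (simp add: component_def)
  then show ?thesis using assms(1)
    by (induction rule: rtrancl_induct) (auto simp: adj_def faces_def)
qed

text \<open>The last step of a path to \<open>s\<close> runs along an edge with apex
  \<open>g\<close>, whose faces have this shape.\<close>

lemma component_nontrivial:
  assumes "s \<in> component g t" "s \<noteq> t"
  shows "Suc (card g) = d" "\<exists>v. v \<notin> g \<and> s = insert v g"
proof -
  have "(t, s) \<in> (adj g)\<^sup>*" using assms by (simp add: component_def)
  then obtain r where "(r, s) \<in> adj g"
    using assms(2) by (auto elim: rtranclE)
  then obtain b where b: "b \<in> edges g" "s \<in> faces b" by (auto simp: adj_def)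
  show "Suc (card g) = d" "\<exists>v. v \<notin> g \<and> s = insert v g"
    using b by (auto elim!: edgesE)
qed

text \<open>For fixed \<open>g\<close> the components partition \<open>bottom\<close>, so a vertex
  determines its block. Sums over blocks thus become cardinalities of sets of pairs, which can index
  the equations or unknowns of a linear system.\<close>

lemma card_component_selection:
  assumes "\<And>V. h V \<subseteq> V"
  shows "card {(g, t). t \<in> bottom \<and> t \<in> h (component g t)} = (\<Sum>(g, V)\<in>blocks. card (h V))"
proof -
  let ?S = "SIGMA p:blocks. h (snd p)"
  let ?f = "\<lambda>(p, t). (fst p, t)"
  have comp: "component g t = V" "t \<in> bottom" if gv: "(g, V) \<in> blocks" "t \<in> h V" for g V t
  proof -
    obtain t0 where t0: "t0 \<in> bottom" "V = component g t0" using gv by (auto simp: blocks_def)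
    have "t \<in> component g t0" using assms gv t0 by blast
    then show "component g t = V" "t \<in> bottom" using component_eq component_bottom t0 by auto
  qed
  have "inj_on ?f ?S"
  proof (rule inj_onI)
    fix p q assume pq: "p \<in> ?S" "q \<in> ?S" "?f p = ?f q"
    obtain g V t where p: "p = ((g, V), t)" by (metis surj_pair)
    obtain g' V' t' where q: "q = ((g', V'), t')" by (metis surj_pair)
    have "component g t = V" "component g' t' = V'"
      using pq comp(1)[of g V t] comp(1)[of g' V' t'] by (auto simp: p q)
    then show "p = q" using pq(3) by (auto simp: p q)
  qed
  moreover have "?f ` ?S = {(g, t). t \<in> bottom \<and> t \<in> h (component g t)}"
  proof (intro equalityI subsetI)
    fix q assume "q \<in> {(g, t). t \<in> bottom \<and> t \<in> h (component g t)}"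
    then obtain g t where q: "q = (g, t)" "t \<in> bottom" "t \<in> h (component g t)" by auto
    then show "q \<in> ?f ` ?S"
      by (intro image_eqI[of _ _ "((g, component g t), t)"]) (auto simp: blocks_def)
  next
    fix q assume "q \<in> ?f ` ?S"
    then obtain g V t where q: "q = (g, t)" "(g, V) \<in> blocks" "t \<in> h V" by auto
    then show "q \<in> {(g, t). t \<in> bottom \<and> t \<in> h (component g t)}"
      using comp[OF q(2,3)] by auto
  qed
  ultimately have "card {(g, t). t \<in> bottom \<and> t \<in> h (component g t)} = card ?S"
    using card_image[of ?f ?S] by (simp only:)
  also have "\<dots> = (\<Sum>p\<in>blocks. card (h (snd p)))"
    by (subst card_SigmaI) auto
  finally show ?thesis by (simp add: case_prod_unfold)
qed

text \<open>Let n be the number of variables. If \<open>V\<close> has two vertices or more, all are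
  of the form \<open>insert v g\<close>: none avoids an index in \<open>g\<close>, and each index
  outside \<open>g\<close> is avoided by at least one. Since \<open>g\<close> has d - 1 elements,
  one is subtracted for n - d + 1 indices from a total of (n - d) times \<open>card V\<close>, one
  more than needed.\<close>

lemma block_count:
  assumes V: "(g, V) \<in> blocks" and d: "d < CARD('n)"
  shows "(\<Sum>j\<in>UNIV. card {s \<in> V. j \<notin> s} - 1) \<le> (CARD('n) - d) * (card V - 1)"
    and "card V \<ge> 2 \<Longrightarrow>
      (\<Sum>j\<in>UNIV. card {s \<in> V. j \<notin> s} - 1) < (CARD('n) - d) * (card V - 1)"
proof -
  obtain t where t: "t \<in> bottom" "V = component g t" using V by (auto simp: blocks_def)
  have bot: "card s = d" if "s \<in> V" for s
    using component_bottom[of t s g] t that by (auto simp: bottom_def)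
  have small: "(\<Sum>j\<in>UNIV. card {s \<in> V. j \<notin> s} - 1) = 0" if "card V \<le> 1"
  proof (rule sum.neutral, rule ballI)
    fix j
    have "card {s \<in> V. j \<notin> s} \<le> card V" by (intro card_mono) auto
    then show "card {s \<in> V. j \<notin> s} - 1 = 0" using that by simp
  qed
  have large: "(\<Sum>j\<in>UNIV. card {s \<in> V. j \<notin> s} - 1) < (CARD('n) - d) * (card V - 1)"
    if V2: "card V \<ge> 2"
  proof -
    have ex: "\<exists>v. v \<notin> g \<and> s = insert v g" and cg: "Suc (card g) = d" if s: "s \<in> V" for s
    proof -
      have "\<not> V \<subseteq> {s}" using V2 card_mono[of "{s}" V] by auto
      then obtain s' where "s' \<in> V" "s' \<noteq> s" by blast
      then have "component g s = V" "component g s' = V"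
        using component_eq s unfolding t(2) by blast+
      then have "s' \<in> component g s" "s \<in> component g s'" using s \<open>s' \<in> V\<close> by simp_all
      then show "\<exists>v. v \<notin> g \<and> s = insert v g" "Suc (card g) = d"
        using component_nontrivial \<open>s' \<noteq> s\<close> by blast+
    qed
    have "V \<noteq> {}" using V2 by auto
    then have cg: "Suc (card g) = d" using cg by blast
    have in_g: "card {s \<in> V. j \<notin> s} - 1 = 0" if "j \<in> g" for j
    proof -
      have "{s \<in> V. j \<notin> s} = {}" using ex that by blast
      then show ?thesis by (metis card.empty diff_0_eq_0)
    qed
    have out_g: "card {s \<in> V. j \<notin> s} \<ge> 1" if j: "j \<notin> g" for j
    proof -
      have "\<not> V \<subseteq> {insert j g}" using V2 card_mono[of "{insert j g}" V] by auto
      then obtain s where "s \<in> V" "s \<noteq> insert j g" by blast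
      moreover obtain v where "s = insert v g" using ex[OF \<open>s \<in> V\<close>] by blast
      ultimately have "s \<in> {s \<in> V. j \<notin> s}" using j by auto
      then have "{s \<in> V. j \<notin> s} \<noteq> {}" by blast
      then show ?thesis by (simp add: Suc_leI card_gt_0_iff)
    qed
    \<comment> \<open>Adding \<open>card (- g)\<close> undoes every truncated subtraction for an
      index outside \<open>g\<close>.\<close>
    have "(\<Sum>j\<in>UNIV. card {s \<in> V. j \<notin> s} - 1) + card (- g)
        = (\<Sum>j\<in>- g. card {s \<in> V. j \<notin> s} - 1) + (\<Sum>j\<in>- g. 1)"
      by (simp, rule sum.mono_neutral_right) (use in_g in auto)
    also have "\<dots> = (\<Sum>j\<in>- g. card {s \<in> V. j \<notin> s})"
    proof -
      have "(\<Sum>j\<in>- g. card {s \<in> V. j \<notin> s} - 1) + (\<Sum>j\<in>- g. 1)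
          = (\<Sum>j\<in>- g. (card {s \<in> V. j \<notin> s} - 1) + 1)"
        by (rule sum.distrib[symmetric])
      also have "\<dots> = (\<Sum>j\<in>- g. card {s \<in> V. j \<notin> s})"
        by (intro sum.cong refl le_add_diff_inverse2 out_g) simp
      finally show ?thesis .
    qed
    also have "\<dots> \<le> (\<Sum>j\<in>UNIV. card {s \<in> V. j \<notin> s})"
      by (intro sum_mono2) auto
    also have "\<dots> = (CARD('n) - d) * card V"
      by (simp add: sum_card_avoiding bot)
    finally have "(\<Sum>j\<in>UNIV. card {s \<in> V. j \<notin> s} - 1) + card (- g) \<le> (CARD('n) - d) * card V" .
    moreover have "card (- g) = Suc (CARD('n) - d)"
      using cg d by (simp add: card_Compl)
    moreover have "(CARD('n) - d) * card V = (CARD('n) - d) * (card V - 1) + (CARD('n) - d)"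
      using V2 by (cases "card V") simp_all
    ultimately show ?thesis by linarith
  qed
  then show "card V \<ge> 2 \<Longrightarrow>
      (\<Sum>j\<in>UNIV. card {s \<in> V. j \<notin> s} - 1) < (CARD('n) - d) * (card V - 1)" .
  show "(\<Sum>j\<in>UNIV. card {s \<in> V. j \<notin> s} - 1) \<le> (CARD('n) - d) * (card V - 1)"
    using small large by (cases "card V \<le> 1") (simp_all add: less_imp_le)
qed

text \<open>
  The vertices of each component except one, counted once for each apex; components with a
  single vertex contribute nothing.
\<close>

definition nonroots :: "('n set \<times> 'n set) set" where
  "nonroots = {(g, t). t \<in> bottom \<and> t \<in> component g t - {pick (component g t)}}"

definition nonroots_avoiding :: "'n \<Rightarrow> ('n set \<times> 'n set) set" where
  "nonroots_avoiding j = {(g, t). t \<in> bottom \<and>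
     t \<in> {s \<in> component g t. j \<notin> s} - {pick {s \<in> component g t. j \<notin> s}}}"

lemma card_nonroots: "card nonroots = (\<Sum>(g, V)\<in>blocks. card V - 1)"
  unfolding nonroots_def by (subst card_component_selection) (auto simp: card_minus_pick)

lemma card_nonroots_avoiding:
  "card (nonroots_avoiding j) = (\<Sum>(g, V)\<in>blocks. card {s \<in> V. j \<notin> s} - 1)"
  unfolding nonroots_avoiding_def
  by (subst card_component_selection) (auto simp: card_minus_pick)

text \<open>By \<open>edge_or_thick\<close>, \<open>b\<close> provides one of two sources of
  strictness: a block with an edge, or a thick element, which has d + 1 points and so is avoided by
  one index fewer than n - d.\<close>

lemma sum_nonroots_avoiding_less:
  assumes "b \<in> P" "card b = Suc d" "faces b \<noteq> {}"
  shows "(\<Sum>j\<in>UNIV. card (nonroots_avoiding j) + card {c \<in> thick. j \<notin> c})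
    < (CARD('n) - d) * (card nonroots + card thick)"
proof -
  have dn: "d < CARD('n)" using card_mono[of UNIV b] assms(2) by simp
  let ?f = "\<lambda>(g :: 'n set, V). \<Sum>j\<in>UNIV. card {s \<in> V. j \<notin> s} - 1"
  let ?h = "\<lambda>(g :: 'n set, V). (CARD('n) - d) * (card (V :: 'n set set) - 1)"
  have le: "?f p \<le> ?h p" if "p \<in> blocks" for p
    using that block_count(1)[OF _ dn] by (cases p) simp
  have strict: "sum ?f blocks < sum ?h blocks" if e: "b \<in> edges g" for g
  proof (rule sum_strict_mono_ex1)
    obtain u v where uv: "u \<notin> g" "v \<notin> g" "u \<noteq> v" "faces b = {insert u g, insert v g}"
      using edgesE[OF e] by metis
    let ?V = "component g (insert u g)"
    have sub: "{insert u g, insert v g} \<subseteq> ?V"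
      using component_adj[OF e] component_refl uv by auto
    have "card {insert u g, insert v g} = 2" using uv by (auto simp: card_insert_if)
    then have V: "card ?V \<ge> 2" using card_mono[OF _ sub] by simp
    have in_b: "(g, ?V) \<in> blocks" using uv by (auto simp: blocks_def faces_def)
    show "\<exists>p\<in>blocks. ?f p < ?h p"
      using in_b block_count(2)[OF in_b dn V] by (intro bexI[OF _ in_b]) simp
  qed (use le in auto)
  have "(\<Sum>j\<in>UNIV. card (nonroots_avoiding j)) = sum ?f blocks"
    unfolding card_nonroots_avoiding by (subst sum.swap) (simp add: case_prod_unfold)
  moreover have "(CARD('n) - d) * card nonroots = sum ?h blocks"
    unfolding card_nonroots by (simp add: sum_distrib_left case_prod_unfold)
  moreover have "sum ?f blocks \<le> sum ?h blocks" by (rule sum_mono) (rule le)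
  moreover have "(\<Sum>j\<in>UNIV. card {c \<in> thick. j \<notin> c}) = card thick * (CARD('n) - Suc d)"
    unfolding sum_card_avoiding by (simp add: thick_def)
  moreover have "(CARD('n) - d) * card thick = card thick * (CARD('n) - Suc d) + card thick"
    using dn by (simp add: Suc_diff_Suc[symmetric] algebra_simps)
  moreover have "card thick > 0 \<or> sum ?f blocks < sum ?h blocks"
    using edge_or_thick[OF assms] strict by (auto simp: card_gt_0_iff)
  ultimately show ?thesis
    unfolding sum.distrib distrib_left by linarith
qed

section \<open>Independent cocycles and the two rank estimates\<close>

lemma thick_not_edge: "b \<in> thick \<Longrightarrow> b \<notin> edges g"
  by (auto simp: thick_def edges_def)

text \<open>The left summand is a vertex coboundary truncated to the edges with one apex.\<close>

definition basic_cocycle :: "('n set \<times> 'n set) + 'n set \<Rightarrow> 'n set \<Rightarrow> 'k::field" where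
  "basic_cocycle a b = (case a of
     Inl (g, t) \<Rightarrow> if b \<in> edges g then coboundary (unit_cochain t) b else 0
   | Inr c \<Rightarrow> unit_cochain c b)"

lemma unit_coboundary_no_faces:
  assumes "t \<in> bottom" "t \<notin> faces b" shows "coboundary (unit_cochain t) b = (0 :: 'k::field)"
  using assms by (intro coboundary_eq_0) (auto simp: faces_def)

lemma basic_cocycle_support:
  assumes "a \<in> nonroots <+> thick" "basic_cocycle a b \<noteq> (0 :: 'k::field)"
  shows "b \<in> P \<and> card b = Suc d"
  using assms by (auto simp: basic_cocycle_def edges_def thick_def split: if_splits sum.splits)

text \<open>All elements below \<open>c\<close> that have a face are edges with one common apex. If
  this is not \<open>g\<close>, the truncated coboundary vanishes below \<open>c\<close>; if it is,
  truncation changes nothing there and the differential squares to zero. Thick elements do not occur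
  below \<open>c\<close>.\<close>

lemma basic_cocycle_closed:
  assumes "a \<in> nonroots <+> thick" "c \<in> P" "card c = d + 2"
  shows "coboundary (basic_cocycle a) c = (0 :: 'k::field)"
proof (cases a)
  case (Inr b)
  then have "b \<in> thick" using assms by auto
  show ?thesis
  proof (rule coboundary_eq_0)
    fix i assume "i \<in> c"
    have "c - {i} \<noteq> b" using thick_not_below[OF \<open>b \<in> thick\<close> assms(2,3)] by blast
    then show "basic_cocycle a (c - {i}) = (0 :: 'k)" by (simp add: basic_cocycle_def Inr)
  qed
next
  case (Inl p)
  obtain g t where a: "a = Inl (g, t)" using Inl by (cases p) auto
  have t: "t \<in> bottom" using assms a by (auto simp: nonroots_def)
  obtain g' where g': "\<And>b. b \<in> P \<Longrightarrow> b \<subseteq> c \<Longrightarrow> card b = Suc d \<Longrightarrow> faces b \<noteq> {} \<Longrightarrow> b \<in> edges g'"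
    using common_apex[OF assms(2,3)] by blast
  show ?thesis
  proof (cases "g' = g")
    case False
    show ?thesis
    proof (rule coboundary_eq_0, rule ccontr)
      fix i assume "i \<in> c" and ne: "basic_cocycle a (c - {i}) \<noteq> (0 :: 'k)"
      then have e: "c - {i} \<in> edges g" by (auto simp: basic_cocycle_def a split: if_splits)
      then have "c - {i} \<in> P" "card (c - {i}) = Suc d" "faces (c - {i}) \<noteq> {}"
        by (auto simp: edges_def)
      then have "c - {i} \<in> edges g'" using g' by blast
      then show False using edges_disjoint e False by blast
    qed
  next
    case True
    have "basic_cocycle a (c - {i}) = (coboundary (unit_cochain t) (c - {i}) :: 'k)" if "i \<in> c" for i
    proof (cases "t \<in> faces (c - {i})")
      case False
      then show ?thesis
        by (simp add: basic_cocycle_def a unit_coboundary_no_faces[OF t])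
    next
      case tf: True
      have "card (c - {i}) = Suc d" using assms that by simp
      moreover have "c - {i} \<in> P"
        by (rule convex[of t c]) (use tf assms in \<open>auto simp: faces_def bottom_def\<close>)
      ultimately have "c - {i} \<in> edges g" using g' tf True by auto
      then show ?thesis by (simp add: basic_cocycle_def a)
    qed
    then have "coboundary (basic_cocycle a) c = (coboundary (coboundary (unit_cochain t)) c :: 'k)"
      unfolding coboundary_def by (intro koszul_diff_cong)
    then show ?thesis by (simp add: coboundary_def koszul_diff_diff)
  qed
qed

text \<open>Exactness lifts the basic cocycles to cochains on \<open>bottom\<close>. If there were
  too many, the lifts would be dependent, and so would their coboundaries; but the basic cocycles
  are independent.\<close>

lemma card_cocycles_le:
  assumes exact: "\<And>z :: 'n set \<Rightarrow> 'k::field. (\<And>b. z b \<noteq> 0 \<Longrightarrow> b \<in> P \<and> card b = Suc d) \<Longrightarrow>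
      (\<And>c. c \<in> P \<Longrightarrow> card c = d + 2 \<Longrightarrow> coboundary z c = 0) \<Longrightarrow>
      \<exists>x. (\<forall>t. x t \<noteq> 0 \<longrightarrow> t \<in> bottom) \<and> (\<forall>b\<in>P. card b = Suc d \<longrightarrow> z b = coboundary x b)"
  shows "card nonroots + card thick \<le> card bottom"
proof (rule ccontr)
  assume neg: "\<not> ?thesis"
  let ?U = "nonroots <+> thick"
  have "card bottom < card ?U" using neg by (simp add: card_Plus)
  have "\<forall>a\<in>?U. \<exists>x :: 'n set \<Rightarrow> 'k. (\<forall>t. x t \<noteq> 0 \<longrightarrow> t \<in> bottom) \<and>
      (\<forall>b\<in>P. card b = Suc d \<longrightarrow> basic_cocycle a b = coboundary x b)"
    using exact basic_cocycle_support basic_cocycle_closed by blast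
  then obtain x :: "_ \<Rightarrow> 'n set \<Rightarrow> 'k" where x: "\<And>a t. a \<in> ?U \<Longrightarrow> x a t \<noteq> 0 \<Longrightarrow> t \<in> bottom"
    "\<And>a b. a \<in> ?U \<Longrightarrow> b \<in> P \<Longrightarrow> card b = Suc d \<Longrightarrow> basic_cocycle a b = coboundary (x a) b"
    by metis
  obtain y where y: "\<And>a. y a \<noteq> 0 \<Longrightarrow> a \<in> ?U" "\<exists>a. y a \<noteq> 0"
    "\<And>t. t \<in> bottom \<Longrightarrow> (\<Sum>a\<in>?U. x a t * y a) = 0"
    using homogeneous_system_nontrivial_solution[OF _ _ \<open>card bottom < card ?U\<close>, of "\<lambda>t a. x a t"]
    by auto
  have zero: "(\<Sum>a\<in>?U. y a * x a t) = 0" for t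
  proof (cases "t \<in> bottom")
    case True
    then show ?thesis using y(3)[of t] by (simp add: mult.commute)
  next
    case False
    then show ?thesis using x(1) by (intro sum.neutral) auto
  qed
  have comb: "(\<Sum>a\<in>?U. y a * basic_cocycle a b) = 0" if "b \<in> P" "card b = Suc d" for b
  proof -
    have "(\<Sum>a\<in>?U. y a * basic_cocycle a b) = coboundary (\<lambda>t. \<Sum>a\<in>?U. y a * x a t) b"
      unfolding coboundary_sum using x(2) that by simp
    then show ?thesis unfolding zero by (simp add: coboundary_eq)
  qed
  have split: "(\<Sum>a\<in>?U. y a * basic_cocycle a b) =
     (\<Sum>p\<in>nonroots. y (Inl p) * basic_cocycle (Inl p) b) + (\<Sum>c\<in>thick. y (Inr c) * unit_cochain c b)" for b
    by (simp add: sum.Plus basic_cocycle_def)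
  \<comment> \<open>At a thick element the relation involves only its own coefficient.\<close>
  have "y (Inr b) = 0" for b
  proof (cases "b \<in> thick")
    case False
    then show ?thesis using y(1) by blast
  next
    case True
    then have "(\<Sum>p\<in>nonroots. y (Inl p) * basic_cocycle (Inl p) b) = 0"
      by (intro sum.neutral) (auto simp: basic_cocycle_def thick_not_edge)
    moreover have "(\<Sum>c\<in>thick. y (Inr c) * unit_cochain c b) = y (Inr b)"
      using True by (simp add: if_distrib[of "\<lambda>c. _ * c"] sum.delta cong: if_cong)
    ultimately show ?thesis using comb[of b] split[of b] True by (simp add: thick_def)
  qed
  moreover have "y (Inl (g, t)) = 0" for g t
  proof (cases "(g, t) \<in> nonroots")
    case False
    then show ?thesis using y(1) by blast
  next
    case True
    \<comment> \<open>The coefficients for one apex, seen as a cochain: it vanishes at the root of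
      each component, and the relation says that its coboundary vanishes on the edges with this
      apex.\<close>
    define q where "q s = y (Inl (g, s))" for s
    have q: "s \<in> bottom" "s \<noteq> pick (component g s)" if "q s \<noteq> 0" for s
    proof -
      have "(g, s) \<in> nonroots" using y(1)[of "Inl (g, s)"] that by (auto simp: q_def)
      then show "s \<in> bottom" "s \<noteq> pick (component g s)" by (auto simp: nonroots_def)
    qed
    have "coboundary q b = 0" if b: "b \<in> edges g" for b
    proof -
      have "b \<notin> thick" using b thick_not_edge by blast
      then have "(\<Sum>c\<in>thick. y (Inr c) * unit_cochain c b) = 0" by (intro sum.neutral) auto
      then have "0 = (\<Sum>p\<in>nonroots. y (Inl p) * basic_cocycle (Inl p) b)"
        using comb[of b] split[of b] b by (simp add: edges_def)
      also have "\<dots> = (\<Sum>p\<in>{g} \<times> bottom. y (Inl p) * basic_cocycle (Inl p) b)"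
      proof (rule sum.mono_neutral_cong)
        fix p assume "p \<in> nonroots - {g} \<times> bottom"
        then obtain g' t where p: "p = (g', t)" "g' \<noteq> g" by (auto simp: nonroots_def)
        then have "b \<notin> edges g'" using edges_disjoint[OF b, of g'] by blast
        then show "y (Inl p) * basic_cocycle (Inl p) b = 0" by (simp add: basic_cocycle_def p)
      next
        fix p assume "p \<in> {g} \<times> bottom - nonroots"
        then show "y (Inl p) * basic_cocycle (Inl p) b = 0" using y(1)[of "Inl p"] by auto
      qed auto
      also have "\<dots> = (\<Sum>s\<in>bottom. q s * coboundary (unit_cochain s) b)"
        by (rule sum.reindex_bij_witness[of _ "\<lambda>s. (g, s)" snd])
          (use b in \<open>auto simp: basic_cocycle_def q_def\<close>)
      also have "\<dots> = coboundary q b"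
        using coboundary_expand[of bottom q b] q by (simp add: mult.commute)
      finally show ?thesis by simp
    qed
    then have edge: "orient g s * q s = orient g r * q r" if "(s, r) \<in> adj g" for s r
      using that coboundary_edge[OF _ q(1)] unfolding adj_def by blast
    \<comment> \<open>Oriented values are constant along paths, so the value at \<open>t\<close> is
      that at the root, namely zero.\<close>
    have "orient g t * q t = orient g s * q s" if "(t, s) \<in> (adj g)\<^sup>*" for s
      using that by induction (auto simp: edge)
    moreover have root: "pick (component g t) \<in> component g t"
      using component_refl by (intro pick_in) auto
    moreover have "q (pick (component g t)) = 0"
      using q(2) component_eq[OF root] by metis
    ultimately have "orient g t * q t = 0" by (simp add: component_def)
    then show ?thesis by (simp add: orient_def q_def)
  qed
  ultimately have "y a = 0" for a by (cases a) auto
  then show False using y(2) by simp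
qed

text \<open>Otherwise fewer equations than unknowns give a nonzero \<open>x\<close> whose oriented
  values are constant on the part of each component avoiding \<open>j\<close> and whose coboundary
  vanishes at the thick elements avoiding \<open>j\<close>. An edge avoiding \<open>j\<close> has
  both faces in one such part, so \<open>x\<close> contradicts \<open>inj\<close>.\<close>

lemma card_avoiding_le:
  assumes inj: "\<And>x :: 'n set \<Rightarrow> 'k::field. (\<And>t. x t \<noteq> 0 \<Longrightarrow> t \<in> bottom \<and> j \<notin> t) \<Longrightarrow>
      (\<And>b. b \<in> P \<Longrightarrow> card b = Suc d \<Longrightarrow> j \<notin> b \<Longrightarrow> coboundary x b = 0) \<Longrightarrow> (\<And>t. x t = 0)"
  shows "card {t \<in> bottom. j \<notin> t} \<le> card (nonroots_avoiding j) + card {c \<in> thick. j \<notin> c}"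
proof (rule ccontr)
  assume neg: "\<not> ?thesis"
  let ?U = "{t \<in> bottom. j \<notin> t}"
  let ?E = "nonroots_avoiding j <+> {c \<in> thick. j \<notin> c}"
  let ?root = "\<lambda>g t. pick {s \<in> component g t. j \<notin> s}"
  \<comment> \<open>Row \<open>Inl (g, t)\<close> compares the oriented values at \<open>t\<close>
    and at its root; row \<open>Inr c\<close> is the coboundary at \<open>c\<close>.\<close>
  let ?A = "\<lambda>e s. case e of
      Inl (g, t) \<Rightarrow> (if s = t then orient g t else 0) - (if s = ?root g t then orient g (?root g t) else 0)
    | Inr c \<Rightarrow> (coboundary (unit_cochain s) c :: 'k)"
  have "card ?E < card ?U" using neg by (simp add: card_Plus)
  from homogeneous_system_nontrivial_solution[OF _ _ this, of ?A]
  obtain x :: "'n set \<Rightarrow> 'k" where x: "\<And>t. x t \<noteq> 0 \<Longrightarrow> t \<in> ?U" "\<exists>t. x t \<noteq> 0"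
    "\<And>e. e \<in> ?E \<Longrightarrow> (\<Sum>t\<in>?U. ?A e t * x t) = 0"
    by auto
  have root: "orient g t * x t = orient g (?root g t) * x (?root g t)" if t: "t \<in> ?U" for g t
  proof (cases "t = ?root g t")
    case True
    show ?thesis by (simp only: True[symmetric])
  next
    case False
    have "?root g t \<in> {s \<in> component g t. j \<notin> s}"
      using component_refl t by (intro pick_in) auto
    then have rU: "?root g t \<in> ?U" using component_bottom t by auto
    have "Inl (g, t) \<in> ?E"
      using t False component_refl by (auto simp: nonroots_avoiding_def)
    from x(3)[OF this] have "(\<Sum>s\<in>?U. (if s = t then orient g t * x s else 0)) =
        (\<Sum>s\<in>?U. (if s = ?root g t then orient g (?root g t) * x s else 0))"
      by (simp add: left_diff_distrib sum_subtractf if_distrib[of "\<lambda>c. c * _"] cong: if_cong)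
    then show ?thesis using t rU by (simp add: sum.delta)
  qed
  have "coboundary x b = 0" if b: "b \<in> P" "card b = Suc d" "j \<notin> b" for b
  proof (cases "faces b = {}")
    case True
    then show ?thesis using x(1) by (intro coboundary_eq_0) (fastforce simp: faces_def)
  next
    case False
    then consider "b \<in> thick" | g where "b \<in> edges g" using edge_or_thick b by blast
    then show ?thesis
    proof cases
      case 1
      then have "(\<Sum>t\<in>?U. coboundary (unit_cochain t) b * x t) = 0"
        using x(3)[of "Inr b"] b by auto
      then show ?thesis using coboundary_expand[of ?U x b] x(1) by simp
    next
      case 2
      have xb: "x t \<noteq> 0 \<Longrightarrow> t \<in> bottom" for t using x(1) by blast
      have "orient g s * x s = orient g t * x t" if st: "s \<in> faces b" "t \<in> faces b" for s t
      proof -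
        have "s \<in> ?U" "t \<in> ?U" using st b by (auto simp: faces_def)
        moreover have "component g s = component g t"
          using component_eq[OF component_adj[OF 2 st]] .
        ultimately show ?thesis using root[of s g] root[of t g] by simp
      qed
      then show ?thesis using coboundary_edge[OF 2 xb] by blast
    qed
  qed
  then have "x t = 0" for t using inj[of x] x(1) by blast
  then show False using x(2) by blast
qed

text \<open>Summing the bounds from \<open>inj_avoiding\<close> over all \<open>j\<close> and
  comparing with the bound from \<open>exact\<close> gives a strict inequality of a number with
  itself. If no element of size d + 1 has a face, every cochain on \<open>bottom\<close> is closed,
  against \<open>inj\<close>.\<close>

lemma not_exact:
  assumes ne: "bottom \<noteq> {}"
    and exact: "\<And>z :: 'n set \<Rightarrow> 'k::field. (\<And>b. z b \<noteq> 0 \<Longrightarrow> b \<in> P \<and> card b = Suc d) \<Longrightarrow>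
      (\<And>c. c \<in> P \<Longrightarrow> card c = d + 2 \<Longrightarrow> coboundary z c = 0) \<Longrightarrow>
      \<exists>x. (\<forall>t. x t \<noteq> 0 \<longrightarrow> t \<in> bottom) \<and> (\<forall>b\<in>P. card b = Suc d \<longrightarrow> z b = coboundary x b)"
    and inj: "\<And>x :: 'n set \<Rightarrow> 'k. (\<And>t. x t \<noteq> 0 \<Longrightarrow> t \<in> bottom) \<Longrightarrow>
      (\<And>b. b \<in> P \<Longrightarrow> card b = Suc d \<Longrightarrow> coboundary x b = 0) \<Longrightarrow> (\<And>t. x t = 0)"
    and inj_avoiding: "\<And>j (x :: 'n set \<Rightarrow> 'k). (\<And>t. x t \<noteq> 0 \<Longrightarrow> t \<in> bottom \<and> j \<notin> t) \<Longrightarrow>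
      (\<And>b. b \<in> P \<Longrightarrow> card b = Suc d \<Longrightarrow> j \<notin> b \<Longrightarrow> coboundary x b = 0) \<Longrightarrow> (\<And>t. x t = 0)"
  shows False
proof (cases "\<exists>b\<in>P. card b = Suc d \<and> faces b \<noteq> {}")
  case False
  obtain t where t: "t \<in> bottom" using ne by blast
  have "unit_cochain t t = (0 :: 'k)"
  proof (rule inj[of "unit_cochain t" t])
    show "s \<in> bottom" if "unit_cochain t s \<noteq> (0 :: 'k)" for s
      using that t by (auto split: if_splits)
    show "coboundary (unit_cochain t) b = (0 :: 'k)" if "b \<in> P" "card b = Suc d" for b
      using unit_coboundary_no_faces[OF t] False that by blast
  qed
  then show False by simp
next
  case True
  then obtain b where b: "b \<in> P" "card b = Suc d" "faces b \<noteq> {}" by blast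
  have "(CARD('n) - d) * card bottom = (\<Sum>j\<in>UNIV. card {t \<in> bottom. j \<notin> t})"
    unfolding sum_card_avoiding by (simp add: bottom_def)
  also have "\<dots> \<le> (\<Sum>j\<in>UNIV. card (nonroots_avoiding j) + card {c \<in> thick. j \<notin> c})"
  proof (rule sum_mono)
    fix j
    show "card {t \<in> bottom. j \<notin> t} \<le> card (nonroots_avoiding j) + card {c \<in> thick. j \<notin> c}"
    proof (rule card_avoiding_le)
      fix x :: "'n set \<Rightarrow> 'k" and t
      assume "\<And>t. x t \<noteq> 0 \<Longrightarrow> t \<in> bottom \<and> j \<notin> t"
        and "\<And>b. b \<in> P \<Longrightarrow> card b = Suc d \<Longrightarrow> j \<notin> b \<Longrightarrow> coboundary x b = 0"
      then show "x t = 0" by (rule inj_avoiding[of x j t])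
    qed
  qed
  also have "\<dots> < (CARD('n) - d) * (card nonroots + card thick)"
    by (rule sum_nonroots_avoiding_less[OF b])
  also have "\<dots> \<le> (CARD('n) - d) * card bottom"
    using card_cocycles_le[where ?'k = 'k, OF exact] by simp
  finally show False by simp
qed

end

section \<open>Monomial ideals\<close>

text \<open>The sign is a polynomial on the left and a scalar on the right.\<close>

lemma insertion_sign_mult_lookup:
  "Poly_Mapping.lookup (insertion_sign i G * p) m
   = insertion_sign i G * Poly_Mapping.lookup (p :: ('n::finite, 'k::field) mpoly) m"
proof -
  have "Poly_Mapping.lookup ((-1) ^ e * p) m = (-1) ^ e * Poly_Mapping.lookup p m" for e :: nat
    by (cases "even e") simp_all
  then show ?thesis by (simp add: insertion_sign_def)
qed

lemma insertion_sign_mult_single: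
  "insertion_sign i G * Poly_Mapping.single m c
   = (Poly_Mapping.single m (insertion_sign i G * c) :: ('n::finite, 'k::field) mpoly)"
  by (rule poly_mapping_eqI) (simp add: insertion_sign_mult_lookup lookup_single when_def)

lemma lookup_single_mult:
  fixes p :: "('n::finite, 'k::field) mpoly"
  shows "Poly_Mapping.lookup (Poly_Mapping.single k c * p) (k + m) = c * Poly_Mapping.lookup p m"
  by (simp add: lookup_mult lookup_single when_mult)

lemma lookup_single_mult_eq_0:
  fixes p :: "('n::finite, 'k::field) mpoly"
  assumes "Poly_Mapping.lookup k i > Poly_Mapping.lookup m i"
  shows "Poly_Mapping.lookup (Poly_Mapping.single k c * p) m = 0"
proof (rule ccontr)
  assume "\<not> ?thesis"
  then have "m \<in> Poly_Mapping.keys (Poly_Mapping.single k c * p)" by (simp add: in_keys_iff)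
  then obtain b where "m = k + b"
    using keys_mult[of "Poly_Mapping.single k c" p] by (auto split: if_splits)
  then show False using assms by (simp add: lookup_add)
qed

definition set_expo :: "'n::finite set \<Rightarrow> 'n expo" where
  "set_expo G = (\<Sum>i\<in>G. Poly_Mapping.single i 1)"

lemma lookup_set_expo: "Poly_Mapping.lookup (set_expo G) i = (if i \<in> G then 1 else 0)"
  by (simp add: set_expo_def lookup_sum lookup_single when_def)

lemma set_expo_remove:
  assumes "i \<in> G" shows "Poly_Mapping.single i 1 + set_expo (G - {i}) = set_expo G"
  unfolding set_expo_def using assms by (simp add: sum.remove)

lemma total_degree_set_expo [simp]: "total_degree (set_expo G) = card G"
  by (simp add: total_degree_def lookup_set_expo sum.If_cases)

lemma squarefree_set_expo [simp]: "squarefree_expo (set_expo G)"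
  by (simp add: squarefree_expo_def lookup_set_expo)

lemma squarefree_expoE:
  assumes "squarefree_expo m" obtains G where "m = set_expo G"
proof
  show "m = set_expo (Poly_Mapping.keys m)"
  proof (rule poly_mapping_eqI)
    fix i
    show "Poly_Mapping.lookup m i = Poly_Mapping.lookup (set_expo (Poly_Mapping.keys m)) i"
      using assms[unfolded squarefree_expo_def, rule_format, of i]
      by (auto simp: lookup_set_expo in_keys_iff)
  qed
qed

lemma set_expo_inject: "set_expo G = set_expo H \<longleftrightarrow> G = H"
proof
  assume eq: "set_expo G = set_expo H"
  show "G = H"
  proof (rule Set.set_eqI)
    fix i
    have "Poly_Mapping.lookup (set_expo G) i = Poly_Mapping.lookup (set_expo H) i" by (simp add: eq)
    then show "i \<in> G \<longleftrightarrow> i \<in> H" by (simp add: lookup_set_expo split: if_splits)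
  qed
qed simp

lemma lcm_set_expo: "lcm_expo (set_expo G) (set_expo H) = set_expo (G \<union> H)"
  by (rule poly_mapping_eqI) (simp add: lookup_set_expo)

lemma total_degree_add: "total_degree (m + k) = total_degree m + total_degree k"
  by (simp add: total_degree_def lookup_add sum.distrib)

lemma ideal_set_iff: "ideal N (ring_of_type_algebra :: 'a::comm_ring_1 ring) \<longleftrightarrow> ideal_set N"
proof
  assume "ideal N (ring_of_type_algebra :: 'a ring)"
  then interpret ideal N "ring_of_type_algebra :: 'a ring" .
  show "ideal_set N"
    using additive_subgroup.zero_closed[OF is_additive_subgroup]
      additive_subgroup.a_closed[OF is_additive_subgroup] I_l_closed
    by (auto simp: ideal_set_def ring_of_type_algebra_def)
next
  assume N: "ideal_set N"
  interpret R: cring "ring_of_type_algebra :: 'a ring" by (rule cring_from_type_algebra)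
  have inv: "inv\<^bsub>add_monoid (ring_of_type_algebra :: 'a ring)\<^esub> a = - a" for a
    by (rule group.inv_equality[OF R.a_group]) (auto simp: ring_of_type_algebra_def)
  show "ideal N (ring_of_type_algebra :: 'a ring)"
  proof (rule idealI[OF R.ring_axioms])
    show "subgroup N (add_monoid (ring_of_type_algebra :: 'a ring))"
      by (rule subgroup.intro; (unfold inv)?)
        (use ideal_setD[OF N] in \<open>auto simp: ring_of_type_algebra_def\<close>)
  qed (use ideal_setD(3)[OF N] in \<open>auto simp: ring_of_type_algebra_def mult.commute\<close>)
qed

section \<open>Monomial ideals through exponents\<close>

definition keys_in :: "'n expo set \<Rightarrow> ('n::finite, 'k::field) mpoly set" where
  "keys_in A = {p. Poly_Mapping.keys p \<subseteq> A}"

definition multiples :: "'n::finite expo set \<Rightarrow> 'n expo set" where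
  "multiples G = {g + h | g h. g \<in> G}"

lemma multiples_add: "m \<in> multiples G \<Longrightarrow> m + k \<in> multiples G"
  unfolding multiples_def using add.assoc by blast

lemma ideal_set_keys_in:
  assumes "\<And>m k. m \<in> A \<Longrightarrow> m + k \<in> A"
  shows "ideal_set (keys_in A)"
  unfolding ideal_set_def
proof (intro conjI ballI allI)
  fix a b :: "('a, 'b) mpoly" and c
  assume a: "a \<in> keys_in A"
  show "c * a \<in> keys_in A"
    unfolding keys_in_def
  proof safe
    fix m assume "m \<in> Poly_Mapping.keys (c * a)"
    then obtain k l where "m = k + l" "l \<in> Poly_Mapping.keys a"
      using keys_mult[of c a] by blast
    then show "m \<in> A" using assms[of l k] a by (auto simp: keys_in_def add.commute)
  qed
  assume b: "b \<in> keys_in A"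
  show "a + b \<in> keys_in A"
    using keys_add[of a b] a b by (auto simp: keys_in_def)
qed (simp add: keys_in_def)

lemma single_in_keys_in: "Poly_Mapping.single m c \<in> keys_in A \<longleftrightarrow> c = 0 \<or> m \<in> A"
  by (auto simp: keys_in_def)

lemma mpoly_eq_sum_single: "p = (\<Sum>m\<in>Poly_Mapping.keys p. Poly_Mapping.single m (Poly_Mapping.lookup p m))"
  by (rule poly_mapping_eqI) (auto simp: lookup_sum lookup_single when_def in_keys_iff)

text \<open>The right-hand side is an ideal containing the generators, and each term of a member is
  a multiple of a generator. Membership becomes a condition on exponents.\<close>

lemma monomial_ideal_eq: "monomial_ideal G = (keys_in (multiples G) :: ('n::finite, 'k::field) mpoly set)"
proof
  interpret R: cring "mpoly_ring :: ('n, 'k) mpoly ring" by (rule cring_from_type_algebra)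
  have carr: "monomial ` G \<subseteq> carrier (mpoly_ring :: ('n, 'k) mpoly ring)"
    by (simp add: ring_of_type_algebra_def)
  have "ideal (keys_in (multiples G)) (mpoly_ring :: ('n, 'k) mpoly ring)"
    unfolding ideal_set_iff by (rule ideal_set_keys_in) (rule multiples_add)
  moreover have "g \<in> multiples G" if "g \<in> G" for g
    using that unfolding multiples_def by (metis (mono_tags, lifting) add.right_neutral mem_Collect_eq)
  then have "monomial ` G \<subseteq> (keys_in (multiples G) :: ('n, 'k) mpoly set)"
    by (auto simp: monomial_def single_in_keys_in)
  ultimately show "monomial_ideal G \<subseteq> (keys_in (multiples G) :: ('n, 'k) mpoly set)"
    unfolding monomial_ideal_def by (rule R.genideal_minimal)
  have "ideal (monomial_ideal G) (mpoly_ring :: ('n, 'k) mpoly ring)"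
    unfolding monomial_ideal_def by (rule R.genideal_ideal[OF carr])
  then have I: "ideal_set (monomial_ideal G :: ('n, 'k) mpoly set)"
    by (simp only: ideal_set_iff)
  show "(keys_in (multiples G) :: ('n, 'k) mpoly set) \<subseteq> monomial_ideal G"
  proof
    fix p :: "('n, 'k) mpoly" assume p: "p \<in> keys_in (multiples G)"
    have "Poly_Mapping.single m (Poly_Mapping.lookup p m) \<in> monomial_ideal G" if m: "m \<in> Poly_Mapping.keys p" for m
    proof -
      obtain g h where gh: "m = g + h" "g \<in> G"
        using p m by (auto simp: keys_in_def multiples_def)
      have "monomial g \<in> (monomial_ideal G :: ('n, 'k) mpoly set)"
        unfolding monomial_ideal_def using R.genideal_self[OF carr] gh by blast
      then have "Poly_Mapping.single h (Poly_Mapping.lookup p m) * monomial g \<in> monomial_ideal G"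
        by (rule ideal_setD(3)[OF I])
      then show ?thesis by (simp add: monomial_def mult_single gh add.commute)
    qed
    then have "(\<Sum>m\<in>Poly_Mapping.keys p. Poly_Mapping.single m (Poly_Mapping.lookup p m)) \<in> monomial_ideal G"
      by (rule ideal_set_sum[OF I])
    then show "p \<in> monomial_ideal G" unfolding mpoly_eq_sum_single[symmetric] .
  qed
qed

abbreviation variable :: "'n::finite \<Rightarrow> ('n, 'k::field) mpoly" where
  "variable i \<equiv> monomial (Poly_Mapping.single i 1)"

text \<open>The combinations of the variables form an ideal. The coefficients serve as the
  functional of a contraction.\<close>

lemma irrelevant_ideal_lincomb:
  assumes "p \<in> (irrelevant_ideal :: ('n::finite, 'k::field) mpoly set)"
  shows "\<exists>s. p = (\<Sum>j\<in>UNIV. s j * variable j)"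
proof -
  interpret R: cring "mpoly_ring :: ('n, 'k) mpoly ring" by (rule cring_from_type_algebra)
  let ?N = "{\<Sum>j\<in>UNIV. s j * variable j | s. True} :: ('n, 'k) mpoly set"
  have "ideal_set ?N"
    unfolding ideal_set_def
  proof (intro conjI ballI allI)
    show "0 \<in> ?N" by (auto intro!: exI[of _ "\<lambda>_. 0"])
    fix a assume "a \<in> ?N"
    then obtain s where a: "a = (\<Sum>j\<in>UNIV. s j * variable j)" by blast
    show "c * a \<in> ?N" for c
      by (auto simp: a sum_distrib_left mult.assoc intro!: exI[of _ "\<lambda>j. c * s j"])
    fix b assume "b \<in> ?N"
    then obtain t where b: "b = (\<Sum>j\<in>UNIV. t j * variable j)" by blast
    show "a + b \<in> ?N"
      by (auto simp: a b sum.distrib distrib_right intro!: exI[of _ "\<lambda>j. s j + t j"])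
  qed
  moreover have "variable i \<in> ?N" for i
    by (auto simp: if_distrib[of "\<lambda>c. c * _"] intro!: exI[of _ "\<lambda>j. if j = i then 1 else 0"] cong: if_cong)
  then have "monomial ` range (\<lambda>i. Poly_Mapping.single i 1) \<subseteq> ?N" by blast
  ultimately have "irrelevant_ideal \<subseteq> ?N"
    unfolding irrelevant_ideal_def monomial_ideal_def ideal_set_iff[symmetric]
    by (intro R.genideal_minimal)
  then show ?thesis using assms by blast
qed

lemma keys_irrelevant_ideal:
  assumes "p \<in> (irrelevant_ideal :: ('n::finite, 'k::field) mpoly set)" "m \<in> Poly_Mapping.keys p"
  shows "total_degree m \<ge> 1"
proof -
  obtain i h where "m = Poly_Mapping.single i 1 + h"
    using assms unfolding irrelevant_ideal_def monomial_ideal_eq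
    by (auto simp: keys_in_def multiples_def)
  moreover have "total_degree (Poly_Mapping.single i 1) = 1"
    by (simp add: total_degree_def lookup_single when_def)
  ultimately show ?thesis by (simp add: total_degree_add)
qed

section \<open>Squarefree multidegrees of the Koszul complex\<close>

lemma keys_inD: "p \<in> keys_in A \<Longrightarrow> Poly_Mapping.lookup p m \<noteq> 0 \<Longrightarrow> m \<in> A"
  by (auto simp: keys_in_def in_keys_iff)

text \<open>Each variable restores the point removed from \<open>G\<close>, so all terms land on one
  monomial. Scalar cochains thus embed as one multidegree of the Koszul complex.\<close>

lemma koszul_diff_single:
  fixes z :: "'n::finite set \<Rightarrow> 'k::field"
  shows "koszul_diff variable (\<lambda>G. Poly_Mapping.single (set_expo G) (z G)) G
    = Poly_Mapping.single (set_expo G) (coboundary z G)"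
proof -
  have "insertion_sign j G * variable j * Poly_Mapping.single (set_expo (G - {j})) (z (G - {j}))
      = Poly_Mapping.single (set_expo G) (insertion_sign j G * z (G - {j}))" if "j \<in> G" for j
    using set_expo_remove[OF that]
    by (simp add: insertion_sign_mult_single mult_single monomial_def mult.assoc)
  moreover have "(\<Sum>j\<in>G. Poly_Mapping.single (set_expo G) (c j)) = Poly_Mapping.single (set_expo G) (sum c G)"
    for c :: "'n \<Rightarrow> 'k"
    by (rule poly_mapping_eqI) (simp add: lookup_sum lookup_single when_def)
  ultimately show ?thesis
    unfolding koszul_diff_def coboundary_eq by simp
qed

text \<open>The projection to the same multidegree, used to turn polynomial primitives into scalar
  ones.\<close>

lemma lookup_koszul_diff:
  fixes u :: "'n::finite set \<Rightarrow> ('n, 'k::field) mpoly"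
  shows "Poly_Mapping.lookup (koszul_diff variable u G) (set_expo G)
    = coboundary (\<lambda>t. Poly_Mapping.lookup (u t) (set_expo t)) G"
proof -
  have "Poly_Mapping.lookup (insertion_sign j G * variable j * u (G - {j})) (set_expo G)
      = insertion_sign j G * Poly_Mapping.lookup (u (G - {j})) (set_expo (G - {j}))" if "j \<in> G" for j
    using lookup_single_mult[of "Poly_Mapping.single j 1" 1 "u (G - {j})" "set_expo (G - {j})"]
    unfolding set_expo_remove[OF that] by (simp add: insertion_sign_mult_lookup monomial_def mult.assoc)
  then show ?thesis
    unfolding koszul_diff_def coboundary_eq lookup_sum by simp
qed

text \<open>Vanishing of the Koszul cohomology of the quotient in degree \<open>e\<close>. The
  \<open>itself\<close> argument names the field, which sets of exponents do not determine.\<close>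

definition koszul_exact :: "'n::finite expo set \<Rightarrow> 'n expo set \<Rightarrow> 'k::field itself \<Rightarrow> nat \<Rightarrow> bool" where
  "koszul_exact M\<^sub>I M\<^sub>J _ e \<longleftrightarrow> (\<forall>z :: 'n set \<Rightarrow> ('n, 'k) mpoly. (\<forall>G. z G \<in> keys_in M\<^sub>I) \<longrightarrow>
     (\<forall>G. card G = Suc e \<longrightarrow> koszul_diff variable z G \<in> keys_in M\<^sub>J) \<longrightarrow>
     (\<exists>u. (\<forall>G. u G \<in> keys_in M\<^sub>I) \<and>
       (\<forall>G. card G = e \<longrightarrow> z G - koszul_diff variable u G \<in> keys_in M\<^sub>J)))"

lemma koszul_exactE:
  fixes z :: "'n::finite set \<Rightarrow> ('n, 'k::field) mpoly"
  assumes "koszul_exact M\<^sub>I M\<^sub>J TYPE('k) e" "\<And>G. z G \<in> keys_in M\<^sub>I"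
    "\<And>G. card G = Suc e \<Longrightarrow> koszul_diff variable z G \<in> keys_in M\<^sub>J"
  obtains u where "\<And>G. u G \<in> keys_in M\<^sub>I"
    "\<And>G. card G = e \<Longrightarrow> z G - koszul_diff variable u G \<in> keys_in M\<^sub>J"
proof -
  have "\<forall>G. z G \<in> keys_in M\<^sub>I"
    "\<forall>G. card G = Suc e \<longrightarrow> koszul_diff variable z G \<in> keys_in M\<^sub>J"
    using assms by blast+
  from assms(1)[unfolded koszul_exact_def, THEN spec, THEN mp, THEN mp, OF this]
  show thesis using that by blast
qed

context
  fixes M\<^sub>I M\<^sub>J :: "'n::finite expo set"
  assumes up: "\<And>m k. m \<in> M\<^sub>I \<Longrightarrow> m + k \<in> M\<^sub>I" "\<And>m k. m \<in> M\<^sub>J \<Longrightarrow> m + k \<in> M\<^sub>J"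
begin

lemma set_expo_mono:
  assumes "set_expo G \<in> M\<^sub>I" "G \<subseteq> H" shows "set_expo H \<in> M\<^sub>I"
proof -
  have "set_expo H = set_expo G + set_expo (H - G)"
    by (rule poly_mapping_eqI) (use assms(2) in \<open>auto simp: lookup_set_expo lookup_add\<close>)
  then show ?thesis using up(1)[OF assms(1)] by metis
qed

text \<open>The cocycle is placed in its multidegree, and the coefficients of a polynomial primitive
  are read off.\<close>

lemma squarefree_cocycle_exact:
  fixes z :: "'n set \<Rightarrow> 'k::field"
  assumes ex: "koszul_exact M\<^sub>I M\<^sub>J TYPE('k) e"
    and z: "\<And>b. z b \<noteq> 0 \<Longrightarrow> set_expo b \<in> M\<^sub>I - M\<^sub>J"
    and dz: "\<And>c. set_expo c \<in> M\<^sub>I - M\<^sub>J \<Longrightarrow> card c = Suc e \<Longrightarrow> coboundary z c = 0"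
  shows "\<exists>u. (\<forall>t. u t \<noteq> 0 \<longrightarrow> set_expo t \<in> M\<^sub>I) \<and>
    (\<forall>b. set_expo b \<in> M\<^sub>I - M\<^sub>J \<longrightarrow> card b = e \<longrightarrow> z b = coboundary u b)"
proof -
  let ?z = "\<lambda>G. Poly_Mapping.single (set_expo G) (z G)"
  have "koszul_diff variable ?z c \<in> keys_in M\<^sub>J" if "card c = Suc e" for c
  proof (cases "set_expo c \<in> M\<^sub>I")
    case True
    then show ?thesis unfolding koszul_diff_single single_in_keys_in using dz that by blast
  next
    case False
    have "coboundary z c = 0"
    proof (rule coboundary_eq_0, rule ccontr)
      fix i assume "z (c - {i}) \<noteq> 0"
      then have "set_expo c \<in> M\<^sub>I" using z set_expo_mono[of "c - {i}" c] by blast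
      then show False using False by blast
    qed
    then show ?thesis unfolding koszul_diff_single single_in_keys_in by blast
  qed
  moreover have "?z G \<in> keys_in M\<^sub>I" for G
    unfolding single_in_keys_in using z by blast
  ultimately obtain u where u: "\<And>G. u G \<in> keys_in M\<^sub>I"
    "\<And>G. card G = e \<Longrightarrow> ?z G - koszul_diff variable u G \<in> keys_in M\<^sub>J"
    using koszul_exactE[OF ex, of ?z] by blast
  have "z b = coboundary (\<lambda>t. Poly_Mapping.lookup (u t) (set_expo t)) b"
    if b: "set_expo b \<in> M\<^sub>I - M\<^sub>J" "card b = e" for b
    using keys_inD[OF u(2)[OF b(2)], of "set_expo b"] b(1)
    unfolding lookup_minus lookup_koszul_diff lookup_single_eq by auto
  then show ?thesis
    using keys_inD[OF u(1)] by (intro exI[of _ "\<lambda>t. Poly_Mapping.lookup (u t) (set_expo t)"]) blast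
qed

text \<open>The term of \<open>t\<close> is placed at \<open>insert j t\<close>, which gives a
  cocycle of multidegree (1, ..., 1) - e_j. A primitive would need monomials of degree below
  \<open>d\<close>, so the cocycle already vanishes modulo the smaller ideal.\<close>

lemma squarefree_avoiding_inj:
  fixes x :: "'n set \<Rightarrow> 'k::field"
  assumes ex: "koszul_exact M\<^sub>I M\<^sub>J TYPE('k) (Suc d)"
    and deg: "\<And>m. m \<in> M\<^sub>I \<Longrightarrow> total_degree m \<ge> d"
    and x: "\<And>t. x t \<noteq> 0 \<Longrightarrow> set_expo t \<in> M\<^sub>I - M\<^sub>J \<and> card t = d \<and> j \<notin> t"
    and dx: "\<And>b. set_expo b \<in> M\<^sub>I - M\<^sub>J \<Longrightarrow> card b = Suc d \<Longrightarrow> j \<notin> b \<Longrightarrow> coboundary x b = 0"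
  shows "x t = 0"
proof (rule ccontr)
  assume "x t \<noteq> 0"
  then have t: "set_expo t \<in> M\<^sub>I - M\<^sub>J" "card t = d" "j \<notin> t" using x by auto
  txt \<open>The factor \<^term>\<open>insertion_sign j G\<close> makes this shift by \<open>j\<close> anticommute with the differentials.\<close>
  let ?z = "\<lambda>G. if j \<in> G then Poly_Mapping.single (set_expo (G - {j})) (insertion_sign j G * x (G - {j})) else 0"
  have "?z G \<in> keys_in M\<^sub>I" for G
    using x by (auto simp: single_in_keys_in) (simp add: keys_in_def)
  moreover have "koszul_diff variable ?z c \<in> keys_in M\<^sub>J" if c: "card c = Suc (Suc d)" for c
  proof (cases "j \<in> c")
    case False
    then have "koszul_diff variable ?z c = 0"
      unfolding koszul_diff_def by (intro sum.neutral) auto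
    then show ?thesis by (simp add: keys_in_def)
  next
    case j: True
    let ?b = "c - {j}"
    have "insertion_sign i c * variable i * ?z (c - {i})
        = - insertion_sign j c * (insertion_sign i ?b * variable i *
            Poly_Mapping.single (set_expo (?b - {i})) (x (?b - {i})))" if i: "i \<in> ?b" for i
    proof -
      have sw: "c - {i} - {j} = ?b - {i}" and "j \<noteq> i" using i by auto
      have "insertion_sign i c * variable i * ?z (c - {i}) = insertion_sign i c * insertion_sign j (c - {i})
          * (variable i * Poly_Mapping.single (set_expo (?b - {i})) (x (?b - {i})))"
        using i j \<open>j \<noteq> i\<close> by (simp add: sw ac_simps flip: insertion_sign_mult_single)
      also have "insertion_sign i c * insertion_sign j (c - {i})
          = - (insertion_sign j c * insertion_sign i ?b :: ('n, 'k) mpoly)"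
        using i j by (intro insertion_sign_swap) auto
      finally show ?thesis by (simp add: mult.assoc)
    qed
    then have "(\<Sum>i\<in>?b. insertion_sign i c * variable i * ?z (c - {i}))
        = - insertion_sign j c * koszul_diff variable (\<lambda>G. Poly_Mapping.single (set_expo G) (x G)) ?b"
      unfolding koszul_diff_def sum_distrib_left by (intro sum.cong refl)
    moreover have "koszul_diff variable ?z c = (\<Sum>i\<in>?b. insertion_sign i c * variable i * ?z (c - {i}))"
      unfolding koszul_diff_def using j by (intro sum.mono_neutral_right) auto
    ultimately have eq: "koszul_diff variable ?z c
        = - insertion_sign j c * Poly_Mapping.single (set_expo ?b) (coboundary x ?b)"
      by (simp only: koszul_diff_single)
    have "coboundary x ?b = 0 \<or> set_expo ?b \<in> M\<^sub>J"
    proof (cases "set_expo ?b \<in> M\<^sub>I")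
      case True
      then show ?thesis using dx[of ?b] c j by auto
    next
      case False
      have "coboundary x ?b = 0"
      proof (rule coboundary_eq_0, rule ccontr)
        fix i assume "x (?b - {i}) \<noteq> 0"
        then have "set_expo ?b \<in> M\<^sub>I" using x set_expo_mono[of "?b - {i}" ?b] by blast
        then show False using False by blast
      qed
      then show ?thesis by blast
    qed
    then have "Poly_Mapping.single (set_expo ?b) (coboundary x ?b) \<in> keys_in M\<^sub>J"
      by (simp add: single_in_keys_in)
    then show ?thesis
      unfolding eq by (rule ideal_setD(3)[rotated]) (rule ideal_set_keys_in, rule up(2))
  qed
  ultimately obtain u where u: "\<And>G. u G \<in> keys_in M\<^sub>I"
    "\<And>G. card G = Suc d \<Longrightarrow> ?z G - koszul_diff variable u G \<in> keys_in M\<^sub>J"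
    using koszul_exactE[OF ex, of ?z] by blast
  let ?G = "insert j t"
  \<comment> \<open>For \<open>i = j\<close> the variable does not divide the monomial of
    \<open>t\<close>; otherwise the cofactor has degree too small for the ideal.\<close>
  have "Poly_Mapping.lookup (insertion_sign i ?G * variable i * u (?G - {i})) (set_expo t) = 0"
    if i: "i \<in> ?G" for i
  proof (cases "i = j")
    case True
    then have "Poly_Mapping.lookup (variable i * u (?G - {i})) (set_expo t) = 0"
      using t unfolding monomial_def by (intro lookup_single_mult_eq_0[of _ j]) (simp add: lookup_set_expo)
    then show ?thesis by (simp add: insertion_sign_mult_lookup mult.assoc)
  next
    case False
    then have it: "i \<in> t" using i by simp
    have "set_expo (t - {i}) \<notin> M\<^sub>I"
    proof
      assume "set_expo (t - {i}) \<in> M\<^sub>I"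
      from deg[OF this] have "d \<le> card (t - {i})" by simp
      also have "card (t - {i}) < card t" using it by (intro card_Diff1_less) auto
      finally show False using t by simp
    qed
    then have "Poly_Mapping.lookup (u (?G - {i})) (set_expo (t - {i})) = 0"
      using keys_inD[OF u(1)] by blast
    then have "Poly_Mapping.lookup (variable i * u (?G - {i})) (set_expo t) = 0"
      using lookup_single_mult[of "Poly_Mapping.single i 1" 1 "u (?G - {i})" "set_expo (t - {i})"]
      unfolding set_expo_remove[OF it] monomial_def by simp
    then show ?thesis by (simp add: insertion_sign_mult_lookup mult.assoc)
  qed
  then have "Poly_Mapping.lookup (koszul_diff variable u ?G) (set_expo t) = 0"
    unfolding koszul_diff_def lookup_sum by (intro sum.neutral) blast
  moreover have "?G - {j} = t" using t by auto
  ultimately have "Poly_Mapping.lookup (?z ?G - koszul_diff variable u ?G) (set_expo t)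
      = insertion_sign j ?G * x t"
    by (simp add: lookup_minus)
  moreover have "card ?G = Suc d" using t by simp
  ultimately have "set_expo t \<in> M\<^sub>J"
    using keys_inD[OF u(2)[of ?G], of "set_expo t"] \<open>x t \<noteq> 0\<close> by simp
  then show False using t by blast
qed

end

section \<open>Regular sequences on \<open>I / J\<close>\<close>

context
  fixes I J :: "'a::comm_ring_1 set"
  assumes I: "ideal_set I" and J: "ideal_set J" and JI: "J \<subseteq> I"
begin

abbreviation residue_class :: "'a \<Rightarrow> 'a set" where
  "residue_class x \<equiv> J +>\<^bsub>ideal_module ring_of_type_algebra I\<^esub> x"

abbreviation quotient :: "('a, 'a set) module" where
  "quotient \<equiv> quot_module (ideal_module ring_of_type_algebra I) J"

lemma modules:
  "module ring_of_type_algebra (ideal_module ring_of_type_algebra I)"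
  "submodule J ring_of_type_algebra (ideal_module ring_of_type_algebra I)"
  "module ring_of_type_algebra quotient"
proof -
  have "cring (ring_of_type_algebra :: 'a ring)" by (rule cring_from_type_algebra)
  moreover have "ideal I ring_of_type_algebra" "ideal J ring_of_type_algebra"
    using I J by (simp_all add: ideal_set_iff)
  ultimately show "module ring_of_type_algebra (ideal_module ring_of_type_algebra I)"
    "submodule J ring_of_type_algebra (ideal_module ring_of_type_algebra I)"
    using JI by (simp_all add: module_ideal_module submodule_ideal_module)
  then show "module ring_of_type_algebra quotient" by (rule module_quot_module)
qed

lemma residue_class_eq: "residue_class x = {h + x | h. h \<in> J}"
  by (auto simp: a_r_coset_def' ideal_module_def ring_of_type_algebra_def)

lemma residue_class_eq_iff: "residue_class x = residue_class y \<longleftrightarrow> x - y \<in> J"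
proof
  assume "residue_class x = residue_class y"
  moreover have "x \<in> residue_class x"
    using ideal_setD(1)[OF J] by (auto simp: residue_class_eq)
  ultimately show "x - y \<in> J" by (auto simp: residue_class_eq)
next
  assume xy: "x - y \<in> J"
  have "h + x = (h + (x - y)) + y" "h + y = (h - (x - y)) + x" for h by simp_all
  then show "residue_class x = residue_class y"
    unfolding residue_class_eq using ideal_setD(2,5)[OF J _ xy] by blast
qed

lemma carrier_quotient: "carrier quotient = residue_class ` I"
  by (auto simp: quot_module_def A_RCOSETS_def' ideal_module_def)

lemma add_quotient:
  assumes "x \<in> I" "y \<in> I"
  shows "residue_class x \<oplus>\<^bsub>quotient\<^esub> residue_class y = residue_class (x + y)"
proof -
  interpret A: abelian_subgroup J "ideal_module ring_of_type_algebra I"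
    using modules(1,2) by (rule submodule_imp_abelian_subgroup)
  show ?thesis
    using A.a_rcos_sum[of x y] assms by (simp add: quot_module_def ideal_module_def ring_of_type_algebra_def)
qed

lemma smult_quotient:
  assumes "x \<in> I"
  shows "a \<odot>\<^bsub>quotient\<^esub> residue_class x = residue_class (a * x)"
  using quot_module_smult_coset[OF modules(1,2), of a x] assms
  by (simp add: ideal_module_def ring_of_type_algebra_def)

lemma zero_quotient: "\<zero>\<^bsub>quotient\<^esub> = residue_class 0"
  by (simp add: residue_class_eq) (simp add: quot_module_def)

lemma submodule_residue_classes:
  assumes N: "ideal_set N" and NI: "N \<subseteq> I"
  shows "submodule (residue_class ` N) ring_of_type_algebra quotient"
proof -
  interpret Q: module "ring_of_type_algebra" quotient by (rule modules(3))
  note [simp] = add_quotient smult_quotient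
  have NI': "x \<in> I" if "x \<in> N" for x using that NI by blast
  show ?thesis
  proof (rule Q.submoduleI)
    show "residue_class ` N \<subseteq> carrier quotient" using NI by (auto simp: carrier_quotient)
    show "\<zero>\<^bsub>quotient\<^esub> \<in> residue_class ` N"
      using ideal_setD(1)[OF N] by (auto simp: zero_quotient)
  next
    fix U assume "U \<in> residue_class ` N"
    then obtain x where x: "x \<in> N" "U = residue_class x" by blast
    have mx: "- x \<in> N" using x ideal_setD(4)[OF N] by blast
    have "\<ominus>\<^bsub>quotient\<^esub> U = residue_class (- x)"
    proof (rule Q.M.minus_equality)
      show "residue_class (- x) \<oplus>\<^bsub>quotient\<^esub> U = \<zero>\<^bsub>quotient\<^esub>"
        using x NI' mx by (simp add: zero_quotient)
    qed (use x NI' mx in \<open>auto simp: carrier_quotient\<close>)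
    then show "\<ominus>\<^bsub>quotient\<^esub> U \<in> residue_class ` N" using mx by blast
  next
    fix U V assume "U \<in> residue_class ` N" "V \<in> residue_class ` N"
    then obtain x y where "x \<in> N" "U = residue_class x" "y \<in> N" "V = residue_class y" by blast
    then show "U \<oplus>\<^bsub>quotient\<^esub> V \<in> residue_class ` N"
      using ideal_setD(2)[OF N] NI' by auto
  next
    fix a U assume "U \<in> residue_class ` N"
    then obtain x where "x \<in> N" "U = residue_class x" by blast
    then show "a \<odot>\<^bsub>quotient\<^esub> U \<in> residue_class ` N"
      using ideal_setD(3)[OF N] NI' by auto
  qed
qed

lemma residue_class_in_iff:
  assumes "ideal_set N" "J \<subseteq> N"
  shows "residue_class x \<in> residue_class ` N \<longleftrightarrow> x \<in> N"
proof
  assume "residue_class x \<in> residue_class ` N"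
  then obtain y where y: "y \<in> N" "x - y \<in> J" using residue_class_eq_iff by auto
  then have "x - y + y \<in> N" using assms ideal_setD(2)[OF assms(1)] by blast
  then show "x \<in> N" by simp
qed blast

text \<open>The preimage in \<open>I\<close> of the submodule of the quotient generated by multiples
  of the first \<open>m\<close> entries, so that the Koszul argument needs no cosets.\<close>

fun iterated_sum :: "'a list \<Rightarrow> nat \<Rightarrow> 'a set" where
  "iterated_sum as 0 = J"
| "iterated_sum as (Suc m) = {u + as ! m * v | u v. u \<in> iterated_sum as m \<and> v \<in> I}"

lemma iterated_sum_SucI:
  "u \<in> iterated_sum as m \<Longrightarrow> v \<in> I \<Longrightarrow> u + as ! m * v \<in> iterated_sum as (Suc m)"
  by auto

lemma ideal_iterated_sum: "ideal_set (iterated_sum as m)"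
proof (induction m)
  case (Suc m)
  note N = ideal_setD[OF Suc]
  note II = ideal_setD[OF I]
  show ?case
    unfolding ideal_set_def
  proof (intro conjI ballI allI)
    show "0 \<in> iterated_sum as (Suc m)"
      using iterated_sum_SucI[OF N(1) II(1)] by simp
    fix a assume "a \<in> iterated_sum as (Suc m)"
    then obtain u v where a: "a = u + as ! m * v" "u \<in> iterated_sum as m" "v \<in> I" by auto
    have "c * a = c * u + as ! m * (c * v)" for c by (simp add: a algebra_simps)
    then show "c * a \<in> iterated_sum as (Suc m)" for c
      using iterated_sum_SucI[OF N(3)[OF a(2)] II(3)[OF a(3)]] by simp
    fix b assume "b \<in> iterated_sum as (Suc m)"
    then obtain u' v' where b: "b = u' + as ! m * v'" "u' \<in> iterated_sum as m" "v' \<in> I" by auto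
    have "a + b = (u + u') + as ! m * (v + v')" by (simp add: a b algebra_simps)
    then show "a + b \<in> iterated_sum as (Suc m)"
      using iterated_sum_SucI[OF N(2)[OF a(2) b(2)] II(2)[OF a(3) b(3)]] by simp
  qed
qed (simp add: J)

lemma iterated_sum_Suc: "iterated_sum as m \<subseteq> iterated_sum as (Suc m)"
  using iterated_sum_SucI[OF _ ideal_setD(1)[OF I]] by (metis add.right_neutral mult_zero_right subsetI)

lemma iterated_sum_subset: "iterated_sum as m \<subseteq> I"
proof (induction m)
  case (Suc m)
  then show ?case using ideal_setD(2,3)[OF I] by auto
qed (simp add: JI)

lemma J_subset_iterated_sum: "J \<subseteq> iterated_sum as m"
proof (induction m)
  case (Suc m)
  then show ?case using iterated_sum_Suc by blast
qed simp

lemma iterated_sum_mult: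
  assumes "i < m" "v \<in> I" shows "as ! i * v \<in> iterated_sum as m"
  using assms(1)
proof (induction m)
  case (Suc m)
  show ?case
  proof (cases "i = m")
    case True
    then show ?thesis
      using iterated_sum_SucI[OF ideal_setD(1)[OF ideal_iterated_sum] assms(2)] by (metis add_0)
  next
    case False
    then have "as ! i * v \<in> iterated_sum as m" using Suc by simp
    then show ?thesis using iterated_sum_Suc by blast
  qed
qed simp

text \<open>The classes on the right form a submodule with the required products; conversely, any
  such submodule absorbs them one summand at a time.\<close>

lemma ideal_smult_quotient:
  assumes "m \<le> length as"
  shows "ideal_smult ring_of_type_algebra quotient (set (take m as)) = residue_class ` iterated_sum as m"
proof
  have "a \<odot>\<^bsub>quotient\<^esub> U \<in> residue_class ` iterated_sum as m"
    if a: "a \<in> set (take m as)" "U \<in> carrier quotient" for a U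
  proof -
    obtain i where i: "i < m" "a = as ! i"
      using a(1) assms by (auto simp: in_set_conv_nth)
    obtain v where "v \<in> I" "U = residue_class v" using a(2) by (auto simp: carrier_quotient)
    then show ?thesis using iterated_sum_mult[OF i(1)] by (auto simp: smult_quotient i)
  qed
  then show "ideal_smult ring_of_type_algebra quotient (set (take m as)) \<subseteq> residue_class ` iterated_sum as m"
    unfolding ideal_smult_def
    using submodule_residue_classes[OF ideal_iterated_sum iterated_sum_subset] by blast
next
  \<comment> \<open>The bound \<open>m\<close> in the condition on \<open>S\<close> stays fixed
    while the induction runs over \<open>l\<close>.\<close>
  have "residue_class ` iterated_sum as l \<subseteq> S"
    if S: "submodule S ring_of_type_algebra quotient"
      "\<forall>a\<in>set (take m as). \<forall>U\<in>carrier quotient. a \<odot>\<^bsub>quotient\<^esub> U \<in> S" and "l \<le> m" for S l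
    using \<open>l \<le> m\<close>
  proof (induction l)
    case 0
    interpret S: submodule S ring_of_type_algebra quotient by (rule S(1))
    have "residue_class x = residue_class 0" if "x \<in> J" for x
      unfolding residue_class_eq_iff using that by simp
    moreover have "residue_class 0 \<in> S"
      using S.one_closed zero_quotient by simp
    ultimately show ?case by auto
  next
    case (Suc l)
    interpret S: submodule S ring_of_type_algebra quotient by (rule S(1))
    show ?case
    proof
      fix U assume "U \<in> residue_class ` iterated_sum as (Suc l)"
      then obtain u v where uv: "u \<in> iterated_sum as l" "v \<in> I" "U = residue_class (u + as ! l * v)"
        by auto
      have "as ! l \<in> set (take m as)"
        using Suc.prems assms by (auto simp: in_set_conv_nth intro!: exI[of _ l])
      then have "residue_class (as ! l * v) \<in> S"
        using S(2) uv(2) smult_quotient[OF uv(2)] carrier_quotient by (metis imageI)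
      moreover have "residue_class u \<in> S" using Suc uv(1) by auto
      moreover have "u \<in> I" using uv(1) iterated_sum_subset by blast
      moreover have "as ! l * v \<in> I" using uv(2) ideal_setD(3)[OF I] by blast
      ultimately show "U \<in> S"
        using S.m_closed[of "residue_class u" "residue_class (as ! l * v)"]
        by (simp add: uv(3) add_quotient)
    qed
  qed
  then show "residue_class ` iterated_sum as m \<subseteq> ideal_smult ring_of_type_algebra quotient (set (take m as))"
    unfolding ideal_smult_def by blast
qed

lemma regular_sequence_quotientD:
  assumes "regular_sequence ring_of_type_algebra quotient as" "m < length as"
    and "v \<in> I" "as ! m * v \<in> iterated_sum as m"
  shows "v \<in> iterated_sum as m"
proof -
  have eq: "ideal_smult ring_of_type_algebra quotient (set (take m as)) = residue_class ` iterated_sum as m"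
    using assms(2) by (intro ideal_smult_quotient) simp
  have "residue_class v \<in> carrier quotient" using assms(3) by (auto simp: carrier_quotient)
  moreover have "(as ! m) \<odot>\<^bsub>quotient\<^esub> residue_class v \<in> residue_class ` iterated_sum as m"
    using assms(3,4) by (auto simp: smult_quotient)
  ultimately have "residue_class v \<in> residue_class ` iterated_sum as m"
    using assms(1)[unfolded regular_sequence_def, THEN conjunct2, THEN conjunct1, rule_format,
        OF assms(2), of "residue_class v"]
    unfolding eq by simp
  then show ?thesis
    using residue_class_in_iff[OF ideal_iterated_sum J_subset_iterated_sum] by blast
qed

text \<open>The classes of \<open>N\<close> form a proper submodule with all the products. This
  excludes the case in which depth is infinite by convention.\<close>

lemma ideal_smult_quotient_proper:
  assumes N: "ideal_set N" "J \<subseteq> N" "N \<subset> I"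
    and A: "\<And>a v. a \<in> A \<Longrightarrow> v \<in> I \<Longrightarrow> a * v \<in> N"
  shows "ideal_smult ring_of_type_algebra quotient A \<noteq> carrier quotient"
proof
  assume eq: "ideal_smult ring_of_type_algebra quotient A = carrier quotient"
  have "submodule (residue_class ` N) ring_of_type_algebra quotient"
    using N by (intro submodule_residue_classes) auto
  moreover have "\<forall>a\<in>A. \<forall>U\<in>carrier quotient. a \<odot>\<^bsub>quotient\<^esub> U \<in> residue_class ` N"
  proof (intro ballI)
    fix a U assume "a \<in> A" "U \<in> carrier quotient"
    then obtain v where v: "v \<in> I" "U = residue_class v" unfolding carrier_quotient by blast
    then show "a \<odot>\<^bsub>quotient\<^esub> U \<in> residue_class ` N"
      using A[OF \<open>a \<in> A\<close> v(1)] smult_quotient[OF v(1), of a] by simp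
  qed
  ultimately have "ideal_smult ring_of_type_algebra quotient A \<subseteq> residue_class ` N"
    unfolding ideal_smult_def by blast
  then have "residue_class ` I \<subseteq> residue_class ` N" by (simp only: eq carrier_quotient)
  then have "v \<in> N" if "v \<in> I" for v
    using that residue_class_in_iff[OF N(1,2), of v] by blast
  then show False using N(3) by blast
qed

end

text \<open>An instance of \<open>koszul_vanishing\<close>, with the chain of iterated sums starting
  at the smaller ideal.\<close>

lemma koszul_exact_regular_sequence:
  fixes M\<^sub>I M\<^sub>J :: "'n::finite expo set" and as :: "('n, 'k::field) mpoly list"
  assumes up: "\<And>m k. m \<in> M\<^sub>I \<Longrightarrow> m + k \<in> M\<^sub>I" "\<And>m k. m \<in> M\<^sub>J \<Longrightarrow> m + k \<in> M\<^sub>J"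
    and sub: "M\<^sub>J \<subseteq> M\<^sub>I"
    and reg: "regular_sequence mpoly_ring (quot_module (ideal_module mpoly_ring (keys_in M\<^sub>I)) (keys_in M\<^sub>J)) as"
    and irr: "set as \<subseteq> irrelevant_ideal"
    and e: "e < length as"
  shows "koszul_exact M\<^sub>I M\<^sub>J TYPE('k) e"
proof -
  let ?I = "keys_in M\<^sub>I :: ('n, 'k) mpoly set" and ?J = "keys_in M\<^sub>J :: ('n, 'k) mpoly set"
  have I: "ideal_set ?I" by (rule ideal_set_keys_in) (rule up(1))
  have J: "ideal_set ?J" by (rule ideal_set_keys_in) (rule up(2))
  have JI: "?J \<subseteq> ?I" using sub by (auto simp: keys_in_def)
  have "\<exists>s. as ! m = (\<Sum>j\<in>UNIV. s j * variable j)" if "m < length as" for m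
    using irr that by (intro irrelevant_ideal_lincomb) auto
  then obtain s where s: "\<And>m. m < length as \<Longrightarrow> as ! m = (\<Sum>j\<in>UNIV. s m j * variable j)"
    by metis
  show ?thesis
    unfolding koszul_exact_def
  proof (intro allI impI)
    fix z :: "'n set \<Rightarrow> ('n, 'k) mpoly"
    assume z: "\<forall>G. z G \<in> ?I" "\<forall>G. card G = Suc e \<longrightarrow> koszul_diff variable z G \<in> ?J"
    have "\<exists>u. (\<forall>G. u G \<in> ?I) \<and>
        (\<forall>G. card G = e \<longrightarrow> z G - koszul_diff variable u G \<in> iterated_sum ?I ?J as 0)"
    proof (rule koszul_vanishing)
      show "ideal_set ?I" by (rule I)
      show "ideal_set (iterated_sum ?I ?J as m)" for m by (rule ideal_iterated_sum[OF I J JI])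
      show "iterated_sum ?I ?J as m \<subseteq> ?I" for m by (rule iterated_sum_subset[OF I J JI])
      show "iterated_sum ?I ?J as (Suc m) = {u + as ! m * v | u v. u \<in> iterated_sum ?I ?J as m \<and> v \<in> ?I}" for m
        by (rule iterated_sum.simps(2)[OF I J JI])
      show "as ! m = (\<Sum>j\<in>UNIV. s m j * variable j)" if "m < length as" for m
        by (rule s) (rule that)
      show "v \<in> iterated_sum ?I ?J as m"
        if "m < length as" "v \<in> ?I" "as ! m * v \<in> iterated_sum ?I ?J as m" for m v
        by (rule regular_sequence_quotientD[OF I J JI reg that])
      show "0 + e < length as" using e by simp
      show "z G \<in> ?I" for G using z(1) by blast
      show "koszul_diff variable z G \<in> iterated_sum ?I ?J as 0" if "card G = Suc e" for G
        unfolding iterated_sum.simps(1)[OF I J JI] using z(2) that by blast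
    qed
    then show "\<exists>u. (\<forall>G. u G \<in> ?I) \<and>
        (\<forall>G. card G = e \<longrightarrow> z G - koszul_diff variable u G \<in> ?J)"
      unfolding iterated_sum.simps(1)[OF I J JI] .
  qed
qed

section \<open>From the ideals to the poset, and the bound on the depth\<close>

theorem theorem1:
  fixes d r :: nat
    and I J B C W :: "('n::finite, 'k::field) mpoly set"
    and f :: "nat \<Rightarrow> 'n expo"
    and E :: "'n expo set"
  assumes "d \<ge> 1" and "r \<ge> 1"
    and "squarefree_monomial_ideal I" and "squarefree_monomial_ideal J" and "J \<subset> I"
    and "minimal_monomial_generators I (f ` {1..r} \<union> E)"
    and "inj_on f {1..r}"
    and "\<forall>i\<in>{1..r}. squarefree_expo (f i) \<and> total_degree (f i) = d"
    and "\<forall>m\<in>E. squarefree_expo m \<and> total_degree m \<ge> d + 1"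
    and "J = {0} \<or> (\<exists>G. (\<forall>m\<in>G. total_degree m \<ge> d + 1) \<and> J = monomial_ideal G)"
    and "B = squarefree_monomials (d + 1) \<inter> (I - J)"
    and "C = squarefree_monomials (d + 2) \<inter> (I - J)"
    and "W = {monomial (lcm_expo (f i) (f j)) | i j. 1 \<le> i \<and> i < j \<and> j \<le> r}"
    and "B \<inter> monomial_ideal (f ` {1..r}) \<subseteq> W"
    and "C \<inter> W = {}"
  shows "depth mpoly_ring irrelevant_ideal (quot_module (ideal_module mpoly_ring I) J) \<le> enat (d + 1)"
proof -
  note d = assms(1) and BW = assms(14) and CW = assms(15)
  have f: "squarefree_expo (f i)" "total_degree (f i) = d" if "i \<in> {1..r}" for i
    using assms(8) that by auto
  define M\<^sub>I where "M\<^sub>I = multiples (f ` {1..r} \<union> E)"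
  have I: "I = keys_in M\<^sub>I"
    using assms(6) by (simp add: minimal_monomial_generators_def monomial_ideal_eq M\<^sub>I_def)
  have up_I: "m + k \<in> M\<^sub>I" if "m \<in> M\<^sub>I" for m k
    using that unfolding M\<^sub>I_def by (rule multiples_add)
  obtain M\<^sub>J where J: "J = keys_in M\<^sub>J" and up_J: "\<And>m k. m \<in> M\<^sub>J \<Longrightarrow> m + k \<in> M\<^sub>J"
    and deg_J: "\<And>m. m \<in> M\<^sub>J \<Longrightarrow> total_degree m > d"
  proof (cases "J = {0}")
    case True
    \<comment> \<open>The zero ideal has the empty set of exponents.\<close>
    then show thesis by (intro that[of "{}"]) (auto simp: keys_in_def)
  next
    case False
    then obtain G where G: "\<forall>m\<in>G. total_degree m \<ge> d + 1" "J = monomial_ideal G"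
      using assms(10) by blast
    show thesis
    proof (rule that[of "multiples G"])
      show "m + k \<in> multiples G" if "m \<in> multiples G" for m k using that by (rule multiples_add)
      show "total_degree m > d" if "m \<in> multiples G" for m
        using that G(1) by (fastforce simp: multiples_def total_degree_add)
    qed (simp add: G(2) monomial_ideal_eq)
  qed
  have MJI: "M\<^sub>J \<subseteq> M\<^sub>I"
  proof
    fix m assume "m \<in> M\<^sub>J"
    then have "Poly_Mapping.single m 1 \<in> J" by (simp add: J single_in_keys_in)
    then have "Poly_Mapping.single m 1 \<in> I" using assms(5) by blast
    then show "m \<in> M\<^sub>I" by (simp add: I single_in_keys_in)
  qed
  have deg_I: "total_degree m \<ge> d \<and> (total_degree m = d \<longrightarrow> m \<in> f ` {1..r})" if m: "m \<in> M\<^sub>I" for m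
  proof -
    obtain g h where gh: "m = g + h" "g \<in> f ` {1..r} \<union> E"
      using m by (auto simp: M\<^sub>I_def multiples_def)
    have tm: "total_degree m = total_degree g + total_degree h" by (simp add: gh(1) total_degree_add)
    show ?thesis
    proof (cases "g \<in> f ` {1..r}")
      case True
      then have "total_degree g = d" using f by auto
      moreover have "h = 0" if "total_degree h = 0"
        using that by (intro poly_mapping_eqI) (simp add: total_degree_def)
      ultimately show ?thesis using tm True gh(1) by auto
    next
      case False
      then have "total_degree g \<ge> d + 1" using gh assms(9) by blast
      then show ?thesis using tm by simp
    qed
  qed
  have f_in: "f i \<in> M\<^sub>I - M\<^sub>J" if i: "i \<in> {1..r}" for i
  proof -
    have "f i = f i + 0" by simp
    then have "f i \<in> M\<^sub>I" using i unfolding M\<^sub>I_def multiples_def by blast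
    moreover have "f i \<notin> M\<^sub>J" using deg_J[of "f i"] f(2)[OF i] by auto
    ultimately show ?thesis by blast
  qed
  have diff: "monomial m \<in> I - J \<longleftrightarrow> m \<in> M\<^sub>I - M\<^sub>J" for m
    by (simp add: monomial_def I J single_in_keys_in)
  define P where "P = {G. set_expo G \<in> M\<^sub>I - M\<^sub>J}"
  have P_iff: "G \<in> P \<longleftrightarrow> set_expo G \<in> M\<^sub>I - M\<^sub>J" for G by (simp add: P_def)
  have sqf: "monomial (set_expo G) \<in> squarefree_monomials (card G)" for G
    unfolding squarefree_monomials_def by (intro imageI) simp
  have mono_inj: "m = m'" if "monomial m = (monomial m' :: ('n, 'k) mpoly)" for m m'
    using that unfolding monomial_def by (metis keys_single singleton_inject zero_neq_one)
  have bottom_f: "\<exists>i\<in>{1..r}. set_expo t = f i" if "t \<in> P" "card t = d" for t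
    using deg_I[of "set_expo t"] that by (auto simp: P_iff)
  have f_bottom: "\<exists>t\<in>P. card t = d \<and> f i = set_expo t" if i: "i \<in> {1..r}" for i
  proof -
    obtain t where "f i = set_expo t" using squarefree_expoE[OF f(1)[OF i]] by blast
    then show ?thesis using f(2)[OF i] f_in[OF i] by (auto simp: P_iff)
  qed
  interpret level_poset P d
  proof
    fix A B' C' assume A: "A \<in> P" "C' \<in> P" "A \<subseteq> B'" "B' \<subseteq> C'"
    have split: "set_expo H = set_expo G + set_expo (H - G)" if "G \<subseteq> H" for G H :: "'n set"
      by (rule poly_mapping_eqI) (use that in \<open>auto simp: lookup_set_expo lookup_add\<close>)
    have "set_expo B' \<in> M\<^sub>I" using A up_I split[OF A(3)] by (simp add: P_iff)
    moreover have "set_expo B' \<notin> M\<^sub>J"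
    proof
      assume "set_expo B' \<in> M\<^sub>J"
      then have "set_expo C' \<in> M\<^sub>J" using up_J split[OF A(4)] by simp
      then show False using A by (simp add: P_iff)
    qed
    ultimately show "B' \<in> P" by (simp add: P_iff)
  next
    fix b t assume b: "b \<in> P" "card b = Suc d" and t: "t \<in> P" "card t = d" "t \<subseteq> b"
    \<comment> \<open>A multiple of \<open>f i\<close> in \<open>B\<close> lies in \<open>W\<close>,
      so \<open>b\<close> is the union of two distinct supports of generators of degree
      \<open>d\<close>, and one of them differs from \<open>t\<close>.\<close>
    obtain i where i: "i \<in> {1..r}" "set_expo t = f i" using bottom_f t by blast
    have "set_expo b = f i + set_expo (b - t)"
      unfolding i(2)[symmetric]
      by (rule poly_mapping_eqI) (use t in \<open>auto simp: lookup_set_expo lookup_add\<close>)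
    then have "set_expo b \<in> multiples (f ` {1..r})" using i unfolding multiples_def by blast
    then have "monomial (set_expo b) \<in> (monomial_ideal (f ` {1..r}) :: ('n, 'k) mpoly set)"
      by (simp add: monomial_ideal_eq monomial_def single_in_keys_in)
    moreover have "monomial (set_expo b) \<in> B"
      using b sqf[of b] unfolding assms(11) Int_iff diff by (simp add: P_iff)
    ultimately have "monomial (set_expo b) \<in> W" using BW by blast
    then obtain k l where kl: "1 \<le> k" "k < l" "l \<le> r" "set_expo b = lcm_expo (f k) (f l)"
      unfolding assms(13) using mono_inj by blast
    then have kl': "k \<in> {1..r}" "l \<in> {1..r}" by auto
    obtain u where u: "u \<in> P" "card u = d" "f k = set_expo u" using f_bottom[OF kl'(1)] by blast
    obtain v where v: "v \<in> P" "card v = d" "f l = set_expo v" using f_bottom[OF kl'(2)] by blast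
    have "b = u \<union> v" using kl(4) unfolding u(3) v(3) lcm_set_expo set_expo_inject .
    moreover have "u \<noteq> v"
      using inj_onD[OF assms(7), of k l] kl kl' u v by auto
    ultimately show "\<exists>t'\<in>P. card t' = d \<and> t' \<subseteq> b \<and> t' \<noteq> t"
      using u v by blast
  next
    fix s t assume st: "s \<in> P" "card s = d" "t \<in> P" "card t = d" "card (s \<union> t) = d + 2"
    obtain k where k: "k \<in> {1..r}" "set_expo s = f k" using bottom_f st by blast
    obtain l where l: "l \<in> {1..r}" "set_expo t = f l" using bottom_f st by blast
    have "k \<noteq> l"
    proof
      assume "k = l"
      then have "s = t" using k l by (simp flip: set_expo_inject)
      then show False using st by simp
    qed
    \<comment> \<open>Both orders are kept because \<open>W\<close> puts the smaller index
      first.\<close>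
    have "set_expo (s \<union> t) = lcm_expo (f k) (f l)" "set_expo (s \<union> t) = lcm_expo (f l) (f k)"
      unfolding k(2)[symmetric] l(2)[symmetric] lcm_set_expo by (simp_all add: Un_commute)
    moreover have "1 \<le> k" "k \<le> r" "1 \<le> l" "l \<le> r" "k < l \<or> l < k"
      using k l \<open>k \<noteq> l\<close> by auto
    ultimately have "monomial (set_expo (s \<union> t)) \<in> W"
      unfolding assms(13) mem_Collect_eq by metis
    then have "monomial (set_expo (s \<union> t)) \<notin> C" using CW by blast
    moreover have "monomial (set_expo (s \<union> t)) \<in> (squarefree_monomials (d + 2) :: ('n, 'k) mpoly set)"
      using sqf[of "s \<union> t"] unfolding st(5) .
    ultimately show "s \<union> t \<notin> P"
      unfolding assms(12) Int_iff diff P_iff by blast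
  qed
  have bot: "t \<in> bottom \<longleftrightarrow> set_expo t \<in> M\<^sub>I - M\<^sub>J \<and> card t = d" for t
    unfolding bottom_def by (simp add: P_iff)
  have bot': "t \<in> bottom" if "set_expo t \<in> M\<^sub>I" "card t = d" for t
    using that deg_J[of "set_expo t"] by (auto simp: bot)
  obtain t1 where t1: "t1 \<in> P" "card t1 = d" using f_bottom[of 1] assms(2) by auto
  let ?Q = "quot_module (ideal_module mpoly_ring I) J"
  have I_ideal: "ideal_set I" unfolding I by (rule ideal_set_keys_in) (rule up_I)
  have J_ideal: "ideal_set J" unfolding J by (rule ideal_set_keys_in) (rule up_J)
  have JI: "J \<subseteq> I" using assms(5) by blast
  have short: "length as \<le> d + 1"
    if as: "set as \<subseteq> irrelevant_ideal" "regular_sequence mpoly_ring ?Q as" for as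
  proof (rule ccontr)
    assume "\<not> length as \<le> d + 1"
    then have len: "d < length as" "Suc d < length as" by auto
    have ex: "koszul_exact M\<^sub>I M\<^sub>J TYPE('k) e" if "e < length as" for e
    proof (rule koszul_exact_regular_sequence[OF _ _ MJI _ as(1) that])
      show "regular_sequence mpoly_ring (quot_module (ideal_module mpoly_ring (keys_in M\<^sub>I)) (keys_in M\<^sub>J)) as"
        using as(2) unfolding I J .
    qed (use up_I up_J in blast)+
    show False
    \<comment> \<open>Exactness in degree d + 1 provides \<open>exact\<close> and
      \<open>inj_avoiding\<close>, in two different multidegrees; exactness in degree d provides
      \<open>inj\<close>.\<close>
    proof (rule not_exact)
      show "bottom \<noteq> {}" using t1 by (auto simp: bottom_def)
    next
      fix z :: "'n set \<Rightarrow> 'k"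
      assume z: "\<And>b. z b \<noteq> 0 \<Longrightarrow> b \<in> P \<and> card b = Suc d"
        and dz: "\<And>c. c \<in> P \<Longrightarrow> card c = d + 2 \<Longrightarrow> coboundary z c = 0"
      have "\<exists>u. (\<forall>t. u t \<noteq> 0 \<longrightarrow> set_expo t \<in> M\<^sub>I) \<and>
          (\<forall>b. set_expo b \<in> M\<^sub>I - M\<^sub>J \<longrightarrow> card b = Suc d \<longrightarrow> z b = coboundary u b)"
      proof (rule squarefree_cocycle_exact)
        show "set_expo b \<in> M\<^sub>I - M\<^sub>J" if "z b \<noteq> 0" for b using z[OF that] P_iff by blast
        show "coboundary z c = 0" if "set_expo c \<in> M\<^sub>I - M\<^sub>J" "card c = Suc (Suc d)" for c
          using dz[of c] that P_iff by simp
      qed (use up_I up_J ex len in blast)+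
      then obtain u where u: "\<And>t. u t \<noteq> 0 \<Longrightarrow> set_expo t \<in> M\<^sub>I"
        "\<And>b. set_expo b \<in> M\<^sub>I - M\<^sub>J \<Longrightarrow> card b = Suc d \<Longrightarrow> z b = coboundary u b"
        by blast
      \<comment> \<open>The primitive may be nonzero at sets of other sizes; cutting it down to size
        \<open>d\<close> does not change its coboundary at size d + 1.\<close>
      let ?x = "\<lambda>t. if card t = d then u t else 0"
      have "z b = coboundary ?x b" if "b \<in> P" "card b = Suc d" for b
        using u(2)[of b] that by (simp add: P_iff coboundary_eq)
      moreover have "?x t \<noteq> 0 \<Longrightarrow> t \<in> bottom" for t
        using u(1)[of t] bot'[of t] by (auto split: if_splits)
      ultimately show "\<exists>x. (\<forall>t. x t \<noteq> 0 \<longrightarrow> t \<in> bottom) \<and>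
          (\<forall>b\<in>P. card b = Suc d \<longrightarrow> z b = coboundary x b)"
        by (intro exI[of _ ?x]) blast
    next
      fix x :: "'n set \<Rightarrow> 'k" and t
      assume x: "\<And>t. x t \<noteq> 0 \<Longrightarrow> t \<in> bottom"
        and dx: "\<And>b. b \<in> P \<Longrightarrow> card b = Suc d \<Longrightarrow> coboundary x b = 0"
      have "\<exists>u. (\<forall>t. u t \<noteq> 0 \<longrightarrow> set_expo t \<in> M\<^sub>I) \<and>
          (\<forall>b. set_expo b \<in> M\<^sub>I - M\<^sub>J \<longrightarrow> card b = d \<longrightarrow> x b = coboundary u b)"
      proof (rule squarefree_cocycle_exact)
        show "set_expo b \<in> M\<^sub>I - M\<^sub>J" if "x b \<noteq> 0" for b using x[OF that] bot by blast
        show "coboundary x c = 0" if "set_expo c \<in> M\<^sub>I - M\<^sub>J" "card c = Suc d" for c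
          using dx[of c] that P_iff by simp
      qed (use up_I up_J ex len in blast)+
      then obtain u where u: "\<And>t. u t \<noteq> 0 \<Longrightarrow> set_expo t \<in> M\<^sub>I"
        "\<And>b. set_expo b \<in> M\<^sub>I - M\<^sub>J \<Longrightarrow> card b = d \<Longrightarrow> x b = coboundary u b"
        by blast
      show "x t = 0"
      proof (cases "t \<in> bottom")
        case True
        then have t: "set_expo t \<in> M\<^sub>I - M\<^sub>J" "card t = d" by (auto simp: bot)
        \<comment> \<open>The primitive would need a member of \<open>M\<^sub>I\<close> of degree
          below \<open>d\<close>.\<close>
        have "coboundary u t = 0"
        proof (rule coboundary_eq_0, rule ccontr)
          fix i assume i: "i \<in> t" and "u (t - {i}) \<noteq> 0"
          then have "d \<le> card (t - {i})" using deg_I[OF u(1)[of "t - {i}"]] by simp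
          also have "card (t - {i}) < card t" using i by (intro card_Diff1_less) auto
          finally show False using t by simp
        qed
        then show ?thesis using u(2)[OF t] by simp
      next
        case False
        then show ?thesis using x by blast
      qed
    next
      fix j t and x :: "'n set \<Rightarrow> 'k"
      assume x: "\<And>t. x t \<noteq> 0 \<Longrightarrow> t \<in> bottom \<and> j \<notin> t"
        and dx: "\<And>b. b \<in> P \<Longrightarrow> card b = Suc d \<Longrightarrow> j \<notin> b \<Longrightarrow> coboundary x b = 0"
      show "x t = 0"
      proof (rule squarefree_avoiding_inj)
        show "total_degree m \<ge> d" if "m \<in> M\<^sub>I" for m using deg_I[OF that] by blast
        show "set_expo t \<in> M\<^sub>I - M\<^sub>J \<and> card t = d \<and> j \<notin> t" if "x t \<noteq> 0" for t
          using x[OF that] bot by blast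
        show "coboundary x b = 0" if "set_expo b \<in> M\<^sub>I - M\<^sub>J" "card b = Suc d" "j \<notin> b" for b
          using dx[of b] that P_iff by blast
      qed (use up_I up_J ex len in blast)+
    qed
  qed
  \<comment> \<open>The part of \<open>I\<close> above degree \<open>d\<close>: it contains
    \<open>J\<close> and all products with the irrelevant ideal, but no monomial of degree
    \<open>d\<close>.\<close>
  let ?N = "keys_in {m \<in> M\<^sub>I. total_degree m > d} :: ('n, 'k) mpoly set"
  have "ideal_smult mpoly_ring ?Q irrelevant_ideal \<noteq> carrier ?Q"
  proof (rule ideal_smult_quotient_proper[OF I_ideal J_ideal JI, of ?N])
    show "ideal_set ?N"
      by (rule ideal_set_keys_in) (simp add: up_I total_degree_add)
    show "J \<subseteq> ?N" using MJI deg_J by (auto simp: J keys_in_def)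
    have "monomial (set_expo t1) \<in> I" "monomial (set_expo t1) \<notin> ?N"
      using t1 by (simp_all add: I P_iff monomial_def single_in_keys_in)
    moreover have "?N \<subseteq> I" by (auto simp: I keys_in_def)
    ultimately show "?N \<subset> I" by blast
    fix a v :: "('n, 'k) mpoly" assume a: "a \<in> irrelevant_ideal" and v: "v \<in> I"
    show "a * v \<in> ?N"
      unfolding keys_in_def
    proof safe
      fix m assume "m \<in> Poly_Mapping.keys (a * v)"
      then obtain k l where kl: "m = k + l" "k \<in> Poly_Mapping.keys a" "l \<in> Poly_Mapping.keys v"
        using keys_mult[of a v] by blast
      then have "l \<in> M\<^sub>I" using v by (auto simp: I keys_in_def)
      then show "m \<in> M\<^sub>I" "d < total_degree m"
        using up_I[of l k] deg_I[of l] keys_irrelevant_ideal[OF a kl(2)]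
        by (simp_all add: kl(1) add.commute total_degree_add)
    qed
  qed
  then show ?thesis
    unfolding depth_def using short by (auto intro!: Sup_least)
qed

end
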